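(* Let $n\ge 1$ and $m\ge 1$, and let $X=\Gamma(4m)\backslash\mathfrak h_n$. The involution $\tau(Z)=-\overline Z$ of $\mathfrak h_n$ descends to an anti-holomorphic involution of $X$; let $X_{\mathbb R}$ be its fixed point set. Let $S=\bigcup_{\gamma\in\Gamma(4m)}\mathfrak h_n^{\gamma}\subset\mathfrak h_n$. Then: (i) $X_{\mathbb R}$ is exactly the image of $S$ in $X$. (ii) For each $g\in\Gamma_{2m}(2)$, the group ${}^g\Gamma_\ell(4m)=g\Gamma_\ell(4m)g^{-1}$ preserves $g\cdot iC_n$, and the projection $\mathfrak h_n\to X$ induces an injective map from ${}^g\Gamma_\ell(4m)\backslash g\cdot iC_n$ (a copy of $\Gamma_\ell(4m)\backslash C_n$) into $X_{\mathbb R}$. This image depends only on the double coset $\Gamma(4m)\,g\,\Gamma_\ell(2)$, images of distinct double cosets are disjoint, the double coset space $\Gamma(4m)\backslash\Gamma_{2m}(2)/\Gamma_\ell(2)$ is finite, and $$X_{\mathbb R}=\coprod_{g\in\Gamma(4m)\backslash\Gamma_{2m}(2)/\Gamma_\ell(2)}{}^g\Gamma_\ell(4m)\backslash g\cdot iC_n.$$ (iii) The map sending the double coset of $g\in\Gamma_{2m}(2)$ to the cohomology class of the cocycle $f_{\tilde g g^{-1}}$ (note $\tilde gg^{-1}\in\Gamma(4m)$) is a bijection $\Gamma(4m)\backslash\Gamma_{2m}(2)/\Gamma_\ell(2)\to H^1(\mathbb C/\mathbb R,\Gamma(4m))$; thus the copy indexed by $g$ corresponds to the class of $f_\gamma$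 with $\gamma=\tilde gg^{-1}$.
   Context: $\mathbf{Sp}(2n,\mathbb R)$ is the group of real $2n\times 2n$ matrices $g=\begin{pmatrix}A&B\\C&D\end{pmatrix}$ ($n\times n$ blocks) with ${}^tgJg=J$, $J=\begin{pmatrix}0&I_n\\-I_n&0\end{pmatrix}$. Define the involution $\tau\begin{pmatrix}A&B\\C&D\end{pmatrix}=\begin{pmatrix}A&-B\\-C&D\end{pmatrix}$ and write $\tilde g=\tau(g)$. The Siegel space $\mathfrak h_n=\{Z\in M_n(\mathbb C):{}^tZ=Z,\ \mathrm{Im}Z>0\}$ carries the action $gZ=(AZ+B)(CZ+D)^{-1}$; on $\mathfrak h_n$, $\tau(Z)=-\overline Z$, and $\tau(gZ)=\tau(g)\tau(Z)$. For $\gamma\in\mathbf{Sp}(2n,\mathbb R)$, $\mathfrak h_n^\gamma=\{Z\in\mathfrak h_n:\gamma Z=\tau(Z)\}$. $\mathbf{GL}(n,\mathbb R)$ is embedded in $\mathbf{Sp}(2n,\mathbb R)$ by $A\mapsto\mathrm{diag}(A,{}^tA^{-1})$. $C_n$ is the cone of positive definite symmetric real $n\times n$ matrices and $iC_n=\{iY:Y\in C_n\}\subset\mathfrak h_n$. Groups: $\Gamma(N)=\{\gamma\in\mathbf{Sp}(2n,\mathbb Z):\gamma\equiv I\bmod N\}$; $\Gamma_{2m}(2)=\{\begin{pmatrix}A&B\\C&D\end{pmatrix}\in\mathbf{Sp}(2n,\mathbb Z): A,D\equiv I\bmod 2,\ B,C\equiv 0\bmod 2m\}$; $\Gamma_\ell(N)=\{\gamma\in\mathbf{GL}(n,\mathbb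 Z):\gamma\equiv I\bmod N\}$, viewed inside $\mathbf{Sp}(2n,\mathbb Z)$ via the embedding above. Galois cohomology: for a $\tau$-stable subgroup $H$ and $\gamma\in H$ with $\gamma\tilde\gamma=I$, $f_\gamma$ denotes the 1-cocycle $\mathrm{Gal}(\mathbb C/\mathbb R)=\{1,\tau\}\to H$, $1\mapsto I$, $\tau\mapsto\gamma$; $f_\gamma$ and $f_{\gamma'}$ are cohomologous if $\gamma'=\tilde h\gamma h^{-1}$ for some $h\in H$; $H^1(\mathbb C/\mathbb R,H)$ is the set of cohomology classes. *)

theory Defs
  imports "HOL-Analysis.Analysis"
begin

text \<open>Real 2n x 2n matrices are indexed by the sum type 'n + 'n: Inl i is row/column i of the
  first block, Inr i of the second block.  n = CARD('n) is arbitrary (>= 1).\<close>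

type_synonym 'n smat = "real^('n + 'n)^('n + 'n)"

definition blkA :: "'n::finite smat \<Rightarrow> real^'n^'n" where
  "blkA g = (\<chi> i j. g $ Inl i $ Inl j)"
definition blkB :: "'n::finite smat \<Rightarrow> real^'n^'n" where
  "blkB g = (\<chi> i j. g $ Inl i $ Inr j)"
definition blkC :: "'n::finite smat \<Rightarrow> real^'n^'n" where
  "blkC g = (\<chi> i j. g $ Inr i $ Inl j)"
definition blkD :: "'n::finite smat \<Rightarrow> real^'n^'n" where
  "blkD g = (\<chi> i j. g $ Inr i $ Inr j)"

definition blocks :: "real^'n^'n \<Rightarrow> real^'n^'n \<Rightarrow> real^'n^'n \<Rightarrow> real^'n^'n \<Rightarrow> 'n::finite smat" where
  "blocks A B C D = (\<chi> i j. case (i, j) of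
      (Inl a, Inl b) \<Rightarrow> A $ a $ b | (Inl a, Inr b) \<Rightarrow> B $ a $ b
    | (Inr a, Inl b) \<Rightarrow> C $ a $ b | (Inr a, Inr b) \<Rightarrow> D $ a $ b)"

definition Jmat :: "'n::finite smat" where
  "Jmat = blocks 0 (mat 1) (- mat 1) 0"

definition Sp :: "'n::finite smat set" where
  "Sp = {g. transpose g ** Jmat ** g = Jmat}"

definition tauM :: "'n::finite smat \<Rightarrow> 'n smat" where
  "tauM g = blocks (blkA g) (- blkB g) (- blkC g) (blkD g)"

definition cplx :: "real^'n^'n \<Rightarrow> complex^'n^'n" where
  "cplx A = (\<chi> i j. complex_of_real (A $ i $ j))"

definition posdef :: "real^'n^'n \<Rightarrow> bool" where
  "posdef Y \<longleftrightarrow> transpose Y = Y \<and> (\<forall>x. x \<noteq> 0 \<longrightarrow> x \<bullet> (Y *v x) > 0)"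

definition Cn :: "(real^'n^'n) set" where
  "Cn = {Y. posdef Y}"

definition ImM :: "complex^'n^'n \<Rightarrow> real^'n^'n" where
  "ImM Z = (\<chi> i j. Im (Z $ i $ j))"

definition siegel :: "(complex^'n^'n) set" where
  "siegel = {Z. transpose Z = Z \<and> posdef (ImM Z)}"

definition act :: "'n::finite smat \<Rightarrow> complex^'n^'n \<Rightarrow> complex^'n^'n" where
  "act g Z = (cplx (blkA g) ** Z + cplx (blkB g)) ** matrix_inv (cplx (blkC g) ** Z + cplx (blkD g))"

definition tauZ :: "complex^'n^'n \<Rightarrow> complex^'n^'n" where
  "tauZ Z = (\<chi> i j. - cnj (Z $ i $ j))"

definition iCn :: "(complex^'n^'n) set" where
  "iCn = {(\<chi> i j. \<i> * complex_of_real (Y $ i $ j)) | Y. Y \<in> Cn}"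

definition fixset :: "'n::finite smat \<Rightarrow> (complex^'n^'n) set" where
  "fixset \<gamma> = {Z \<in> siegel. act \<gamma> Z = tauZ Z}"

definition intmat :: "real^'m^'k \<Rightarrow> bool" where
  "intmat g \<longleftrightarrow> (\<forall>i j. g $ i $ j \<in> \<int>)"

definition congmat :: "int \<Rightarrow> real^'m^'k \<Rightarrow> real^'m^'k \<Rightarrow> bool" where
  "congmat N g h \<longleftrightarrow> (\<forall>i j. \<exists>k::int. g $ i $ j - h $ i $ j = of_int (N * k))"

definition SpZ :: "'n::finite smat set" where
  "SpZ = {g \<in> Sp. intmat g}"

definition Gam :: "int \<Rightarrow> 'n::finite smat set" where
  "Gam N = {g \<in> SpZ. congmat N g (mat 1)}"

definition Gam2m2 :: "int \<Rightarrow> 'n::finite smat set" where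
  "Gam2m2 m = {g \<in> SpZ. congmat 2 (blkA g) (mat 1) \<and> congmat 2 (blkD g) (mat 1)
                       \<and> congmat (2*m) (blkB g) 0 \<and> congmat (2*m) (blkC g) 0}"

definition embGL :: "real^'n^'n \<Rightarrow> 'n::finite smat" where
  "embGL A = blocks A 0 0 (transpose (matrix_inv A))"

definition GLZ :: "(real^'n^'n) set" where
  "GLZ = {A. intmat A \<and> invertible A \<and> intmat (matrix_inv A)}"

definition Gaml :: "int \<Rightarrow> 'n::finite smat set" where
  "Gaml N = embGL ` {A \<in> GLZ. congmat N A (mat 1)}"

definition orb :: "'n::finite smat set \<Rightarrow> complex^'n^'n \<Rightarrow> (complex^'n^'n) set" where
  "orb G Z = (\<lambda>\<gamma>. act \<gamma> Z) ` G"

definition Xquot :: "'n::finite smat set \<Rightarrow> (complex^'n^'n) set set" where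
  "Xquot G = orb G ` siegel"

definition XR :: "'n::finite smat set \<Rightarrow> (complex^'n^'n) set set" where
  "XR G = {orb G Z | Z. Z \<in> siegel \<and> orb G (tauZ Z) = orb G Z}"

definition conjgrp :: "'n::finite smat \<Rightarrow> 'n smat set \<Rightarrow> 'n smat set" where
  "conjgrp g H = (\<lambda>h. g ** h ** matrix_inv g) ` H"

definition dcoset :: "'n::finite smat set \<Rightarrow> 'n smat \<Rightarrow> 'n smat set \<Rightarrow> 'n smat set" where
  "dcoset G g H = {a ** g ** b | a b. a \<in> G \<and> b \<in> H}"

text \<open>Galois cohomology H^1(C/R, H): cocycles f_gamma are determined by gamma with
  gamma * tau(gamma) = I; the class of f_gamma is the set of gamma' cohomologous to it.\<close>
definition cocycles :: "'n::finite smat set \<Rightarrow> 'n smat set" where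
  "cocycles H = {\<gamma> \<in> H. \<gamma> ** tauM \<gamma> = mat 1}"

definition cohclass :: "'n::finite smat set \<Rightarrow> 'n smat \<Rightarrow> 'n smat set" where
  "cohclass H \<gamma> = {\<gamma>' \<in> cocycles H. \<exists>h \<in> H. \<gamma>' = tauM h ** \<gamma> ** matrix_inv h}"

definition H1 :: "'n::finite smat set \<Rightarrow> 'n smat set set" where
  "H1 H = cohclass H ` cocycles H"

end

theory Submission
  imports Defs
begin

text \<open>
  Write \<open>T = diag(1, -1)\<close>, so that \<open>\<tau>(g) = T g T\<close>. A fixed point of the involution on the quotient
  is represented by \<open>Z\<close> with \<open>\<gamma> Z = \<tau>(Z)\<close> for some \<open>\<gamma> \<in> \<Gamma>(4m)\<close>; then \<open>\<tau>(\<gamma>) \<gamma>\<close> fixes \<open>Z\<close>, and since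
  \<open>\<Gamma>(4m)\<close> acts freely, \<open>\<gamma>\<close> is a cocycle. For a cocycle \<open>\<gamma>\<close> the matrix \<open>\<gamma> T\<close> is an integral
  anti-symplectic involution congruent to \<open>T\<close> modulo \<open>4m\<close>, so its spectral projections are integral
  and split the lattice into two Lagrangian summands. A basis of one summand that is standard
  modulo 2, together with the dual basis of the other, is a matrix \<open>h\<close> with \<open>\<gamma> = h \<tau>(h)\<^sup>-\<^sup>1\<close>,
  and \<open>g = \<tau>(h)\<close> lies in \<open>\<Gamma>\<^sub>2\<^sub>m(2)\<close>. The fixed point set of \<open>\<gamma>\<close> is then \<open>g \<cdot> iC\<^sub>n\<close>. If \<open>h \<in> \<Gamma>\<^sub>2\<^sub>m(2)\<close>
  maps a point of \<open>iC\<^sub>n\<close> into \<open>iC\<^sub>n\<close>, then \<open>h\<^sup>-\<^sup>1 \<tau>(h) \<in> \<Gamma>(4m)\<close> fixes that point, whence \<open>\<tau>(h) = h\<close>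
  and \<open>h\<close> is block diagonal; this gives injectivity and disjointness.
\<close>

subsection \<open>Matrix algebra\<close>

lemma matrix_mul_uminus_left [simp]: "(- A) ** B = - (A ** (B :: 'a::ring_1^'p^'n))"
  by (simp add: vec_eq_iff matrix_matrix_mult_def sum_negf)

lemma matrix_mul_uminus_right [simp]: "A ** (- B) = - (A ** (B :: 'a::ring_1^'p^'n))"
  by (simp add: vec_eq_iff matrix_matrix_mult_def sum_negf)

lemma matrix_add_rdistrib: "(A + B) ** C = A ** C + B ** (C :: 'a::semiring_1^'p^'n)"
  by (simp add: vec_eq_iff matrix_matrix_mult_def sum.distrib distrib_right)

lemma matrix_diff_ldistrib: "A ** (B - C) = A ** B - A ** (C :: 'a::ring_1^'p^'n)"
  by (simp add: vec_eq_iff matrix_matrix_mult_def sum_subtractf right_diff_distrib)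

lemma matrix_diff_rdistrib: "(A - B) ** C = A ** C - B ** (C :: 'a::ring_1^'p^'n)"
  by (simp add: vec_eq_iff matrix_matrix_mult_def sum_subtractf left_diff_distrib)

lemma transpose_add: "transpose (A + B) = transpose A + transpose B"
  by (simp add: vec_eq_iff transpose_def)

lemma transpose_uminus [simp]: "transpose (- A) = - transpose A"
  by (simp add: vec_eq_iff transpose_def)

lemma transpose_zero [simp]: "transpose 0 = 0"
  by (simp add: vec_eq_iff transpose_def)

lemmas matrix_distribs = matrix_add_ldistrib matrix_add_rdistrib
  matrix_diff_ldistrib matrix_diff_rdistrib

lemma matrix_inv_eqI:
  fixes A B :: "'a::field^'n^'n"
  assumes "A ** B = mat 1"
  shows "matrix_inv A = B"
proof -
  have "B ** A = mat 1" using assms by (simp add: matrix_left_right_inverse)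
  then have "\<exists>A'. A ** A' = mat 1 \<and> A' ** A = mat 1" using assms by blast
  from someI_ex[OF this] have "matrix_inv A ** A = mat 1"
    by (simp add: matrix_inv_def)
  then have "matrix_inv A ** A ** B = B" by simp
  then show ?thesis using assms by (simp flip: matrix_mul_assoc)
qed

lemma
  fixes A :: "'a::field^'n^'n"
  assumes "invertible A"
  shows matrix_inv_left: "matrix_inv A ** A = mat 1"
    and matrix_inv_right: "A ** matrix_inv A = mat 1"
  using assms someI_ex[of "\<lambda>A'. A ** A' = mat 1 \<and> A' ** A = mat 1"]
  unfolding invertible_def matrix_inv_def by auto

lemma sum_UNIV_Plus:
  "(\<Sum>i\<in>(UNIV :: ('a::finite + 'b::finite) set). f i) = (\<Sum>i\<in>UNIV. f (Inl i)) + (\<Sum>i\<in>UNIV. f (Inr i))"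
  by (simp flip: UNIV_Plus_UNIV add: sum.Plus)

subsection \<open>Block matrices\<close>

lemma all_sum_iff: "(\<forall>x. P x) \<longleftrightarrow> (\<forall>a. P (Inl a)) \<and> (\<forall>b. P (Inr b))"
  by (metis sum.exhaust)

lemma blocks_nth [simp]:
  "blocks A B C D $ Inl i $ Inl j = A $ i $ j" "blocks A B C D $ Inl i $ Inr j = B $ i $ j"
  "blocks A B C D $ Inr i $ Inl j = C $ i $ j" "blocks A B C D $ Inr i $ Inr j = D $ i $ j"
  by (simp_all add: blocks_def)

lemma blk_blocks [simp]:
  "blkA (blocks A B C D) = A" "blkB (blocks A B C D) = B"
  "blkC (blocks A B C D) = C" "blkD (blocks A B C D) = D"
  by (simp_all add: vec_eq_iff blkA_def blkB_def blkC_def blkD_def)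

lemma blocks_blk [simp]: "blocks (blkA g) (blkB g) (blkC g) (blkD g) = g"
  by (simp add: vec_eq_iff all_sum_iff blkA_def blkB_def blkC_def blkD_def)

lemma blocks_eq_iff [simp]:
  "blocks A B C D = blocks A' B' C' D' \<longleftrightarrow> A = A' \<and> B = B' \<and> C = C' \<and> D = D'"
  by (metis blk_blocks)

lemma blocks_mult:
  "blocks A B C D ** blocks A' B' C' D' =
    blocks (A ** A' + B ** C') (A ** B' + B ** D') (C ** A' + D ** C') (C ** B' + D ** D')"
  by (simp add: vec_eq_iff all_sum_iff matrix_matrix_mult_def sum_UNIV_Plus)

lemma transpose_blocks:
  "transpose (blocks A B C D) = blocks (transpose A) (transpose C) (transpose B) (transpose D)"
  by (simp add: vec_eq_iff all_sum_iff transpose_def)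

lemma mat_1_eq_blocks: "mat 1 = blocks (mat 1) 0 0 (mat 1)"
  by (simp add: vec_eq_iff all_sum_iff mat_def)

lemma uminus_blocks: "- blocks A B C D = blocks (- A) (- B) (- C) (- D)"
  by (simp add: vec_eq_iff all_sum_iff)

text \<open>This shape has two uses: \<open>stack Z (mat 1)\<close> holds homogeneous coordinates of
  a point of the Siegel space, on which symplectic matrices act linearly, and half of a basis of the
  integral lattice is split into blocks in the same way.\<close>

definition stack :: "'a^'n^'n \<Rightarrow> 'a^'n^'n \<Rightarrow> 'a^'n^('n + 'n)" where
  "stack P Q = (\<chi> i. case i of Inl a \<Rightarrow> P $ a | Inr a \<Rightarrow> Q $ a)"

lemma stack_nth [simp]: "stack P Q $ Inl i = P $ i" "stack P Q $ Inr i = Q $ i"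
  by (simp_all add: stack_def)

lemma stack_eq_iff [simp]: "stack P Q = stack P' Q' \<longleftrightarrow> P = P' \<and> Q = Q'"
  by (simp add: vec_eq_iff[of "stack _ _"] all_sum_iff vec_eq_iff[of P] vec_eq_iff[of Q])

lemma stack_mult: "stack P Q ** K = stack (P ** K) (Q ** (K :: 'a::semiring_1^'n^'n))"
  by (simp add: vec_eq_iff all_sum_iff matrix_matrix_mult_def)

lemma stack_uminus: "- stack P Q = stack (- P) (- (Q :: 'a::ring_1^'n^'n))"
  by (simp add: vec_eq_iff all_sum_iff)

lemma stack_exhaust:
  obtains P Q where "V = stack P Q"
proof -
  have "V = stack (\<chi> i. V $ Inl i) (\<chi> i. V $ Inr i)" by (simp add: vec_eq_iff[of V] all_sum_iff)
  then show ?thesis by (rule that)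
qed

lemma blocks_mult_stack: "blocks A B C D ** stack P Q = stack (A ** P + B ** Q) (C ** P + D ** Q)"
  by (simp add: vec_eq_iff all_sum_iff matrix_matrix_mult_def sum_UNIV_Plus)

lemma transpose_stack_mult_stack:
  "transpose (stack P Q) ** stack P' Q' = transpose P ** P' + transpose Q ** (Q' :: 'a::semiring_1^'n^'n)"
  by (simp add: vec_eq_iff matrix_matrix_mult_def transpose_def sum_UNIV_Plus)

lemma stack_mult_transpose_stack:
  "stack P Q ** transpose (stack P' Q') =
    blocks (P ** transpose P') (P ** transpose Q') (Q ** transpose P') (Q ** transpose Q')"
  by (simp add: vec_eq_iff all_sum_iff matrix_matrix_mult_def transpose_def)

section \<open>The involution as conjugation by an anti-symplectic matrix\<close>

definition Tmat :: "'n::finite smat" where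
  "Tmat = blocks (mat 1) 0 0 (- mat 1)"

lemma Tmat_Tmat [simp]: "Tmat ** Tmat = mat 1"
  by (simp add: Tmat_def blocks_mult mat_1_eq_blocks)

lemma transpose_Tmat [simp]: "transpose Tmat = Tmat"
  by (simp add: Tmat_def transpose_blocks)

lemma Jmat_Jmat [simp]: "Jmat ** Jmat = - mat 1"
  by (simp add: Jmat_def blocks_mult mat_1_eq_blocks uminus_blocks)

lemma transpose_Jmat [simp]: "transpose Jmat = - Jmat"
  by (simp add: Jmat_def transpose_blocks uminus_blocks)

lemma Tmat_Jmat: "Tmat ** Jmat = - (Jmat ** Tmat)"
  by (simp add: Tmat_def Jmat_def blocks_mult uminus_blocks)

lemma tauM_eq_conj: "tauM g = Tmat ** g ** Tmat"
proof -
  have "Tmat ** blocks (blkA g) (blkB g) (blkC g) (blkD g) ** Tmat = tauM g"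
    unfolding Tmat_def tauM_def blocks_mult by simp
  then show ?thesis by simp
qed

lemma tauM_tauM [simp]: "tauM (tauM g) = g"
  by (simp add: tauM_def)

lemma tauM_1 [simp]: "tauM (mat 1) = mat 1"
  by (simp add: tauM_eq_conj)

lemma tauM_mult: "tauM (g ** h) = tauM g ** tauM h"
proof -
  have "tauM g ** tauM h = Tmat ** g ** (Tmat ** Tmat) ** h ** Tmat"
    by (simp only: tauM_eq_conj matrix_mul_assoc)
  then show ?thesis by (simp add: tauM_eq_conj matrix_mul_assoc)
qed

subsection \<open>Integral symplectic groups\<close>

text \<open>The symplectic adjoint J^-1 g^t J, written with J^-1 = -J. Being linear in the entries
  of \<open>g\<close>, it carries integrality and congruences over to inverses.\<close>

definition Spinv :: "'n::finite smat \<Rightarrow> 'n smat" where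
  "Spinv g = - (Jmat ** transpose g ** Jmat)"

lemma Spinv_left: "g \<in> Sp \<Longrightarrow> Spinv g ** g = mat 1"
  by (simp add: Spinv_def Sp_def flip: matrix_mul_assoc)

lemma Spinv_right: "g \<in> Sp \<Longrightarrow> g ** Spinv g = mat 1"
  using Spinv_left by (simp add: matrix_left_right_inverse)

lemma Sp_inv: "g \<in> Sp \<Longrightarrow> matrix_inv g = Spinv g"
  by (simp add: matrix_inv_eqI Spinv_right)

lemma Sp_inv_left: "g \<in> Sp \<Longrightarrow> matrix_inv g ** g = mat 1"
  by (simp add: Sp_inv Spinv_left)

lemma Sp_inv_right: "g \<in> Sp \<Longrightarrow> g ** matrix_inv g = mat 1"
  by (simp add: Sp_inv Spinv_right)

lemma Sp_1 [simp]: "mat 1 \<in> Sp"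
  by (simp add: Sp_def)

lemma Sp_mult: "g \<in> Sp \<Longrightarrow> h \<in> Sp \<Longrightarrow> g ** h \<in> Sp"
proof -
  assume "g \<in> Sp" "h \<in> Sp"
  have "transpose (g ** h) ** Jmat ** (g ** h) = transpose h ** (transpose g ** Jmat ** g) ** h"
    by (simp only: matrix_transpose_mul matrix_mul_assoc)
  then show ?thesis using \<open>g \<in> Sp\<close> \<open>h \<in> Sp\<close> by (simp add: Sp_def)
qed

lemma Sp_matrix_inv:
  assumes "g \<in> Sp" shows "matrix_inv g \<in> Sp"
proof -
  let ?h = "matrix_inv g"
  have r: "g ** ?h = mat 1" using assms by (rule Sp_inv_right)
  then have t: "transpose ?h ** transpose g = mat 1" by (metis matrix_transpose_mul transpose_mat)
  have "transpose ?h ** Jmat ** ?h = transpose ?h ** (transpose g ** Jmat ** g) ** ?h"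
    using assms by (simp add: Sp_def)
  also have "\<dots> = (transpose ?h ** transpose g) ** Jmat ** (g ** ?h)"
    by (simp only: matrix_mul_assoc)
  also have "\<dots> = Jmat" by (simp add: r t)
  finally show ?thesis by (simp add: Sp_def)
qed

text \<open>Conjugation by \<open>Tmat\<close> reverses the sign of \<open>Jmat\<close>; this
  happens twice in the computation, and the signs cancel.\<close>

lemma Sp_tauM: assumes "g \<in> Sp" shows "tauM g \<in> Sp"
proof -
  have "transpose (tauM g) ** Jmat ** tauM g = Tmat ** transpose g ** (Tmat ** Jmat ** Tmat) ** g ** Tmat"
    by (simp add: tauM_eq_conj matrix_transpose_mul matrix_mul_assoc)
  also have "Tmat ** Jmat ** Tmat = - Jmat"
    by (simp add: Tmat_Jmat flip: matrix_mul_assoc)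
  also have "Tmat ** transpose g ** (- Jmat) ** g ** Tmat = - (Tmat ** (transpose g ** Jmat ** g) ** Tmat)"
    by (simp flip: matrix_mul_assoc)
  also have "\<dots> = Jmat" using assms by (simp add: Sp_def Tmat_Jmat flip: matrix_mul_assoc)
  finally show ?thesis by (simp add: Sp_def)
qed

lemma matrix_inv_tauM: "g \<in> Sp \<Longrightarrow> matrix_inv (tauM g) = tauM (matrix_inv g)"
  by (rule matrix_inv_eqI) (simp add: Sp_inv_right flip: tauM_mult)

lemma matrix_inv_mult_Sp:
  "g \<in> Sp \<Longrightarrow> h \<in> Sp \<Longrightarrow> matrix_inv (g ** h) = matrix_inv h ** matrix_inv g"
proof (rule matrix_inv_eqI)
  assume "g \<in> Sp" "h \<in> Sp"
  have "g ** h ** (matrix_inv h ** matrix_inv g) = g ** (h ** matrix_inv h) ** matrix_inv g"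
    by (simp only: matrix_mul_assoc)
  then show "g ** h ** (matrix_inv h ** matrix_inv g) = mat 1"
    using \<open>g \<in> Sp\<close> \<open>h \<in> Sp\<close> by (simp add: Sp_inv_right)
qed

lemma matrix_inv_matrix_inv_Sp: "g \<in> Sp \<Longrightarrow> matrix_inv (matrix_inv g) = g"
  by (rule matrix_inv_eqI) (simp add: Sp_inv_left)

section \<open>Integral matrices and entrywise congruences\<close>

lemma intmat_mult: "intmat g \<Longrightarrow> intmat h \<Longrightarrow> intmat (g ** h)"
  unfolding intmat_def matrix_matrix_mult_def by (auto intro!: Ints_sum)

lemma intmat_add: "intmat g \<Longrightarrow> intmat h \<Longrightarrow> intmat (g + h)"
  unfolding intmat_def by auto

lemma intmat_diff: "intmat g \<Longrightarrow> intmat h \<Longrightarrow> intmat (g - h)"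
  unfolding intmat_def by auto

lemma intmat_uminus: "intmat g \<Longrightarrow> intmat (- g)"
  unfolding intmat_def by auto

lemma intmat_transpose: "intmat g \<Longrightarrow> intmat (transpose g)"
  unfolding intmat_def transpose_def by auto

lemma intmat_mat_1 [simp]: "intmat (mat 1)"
  unfolding intmat_def mat_def by auto

lemma intmat_0 [simp]: "intmat 0"
  unfolding intmat_def by auto

lemma intmat_blocks: "intmat (blocks A B C D) \<longleftrightarrow> intmat A \<and> intmat B \<and> intmat C \<and> intmat D"
  by (auto simp: intmat_def all_sum_iff)

lemma intmat_Jmat [simp]: "intmat Jmat" and intmat_Tmat [simp]: "intmat Tmat"
  by (auto simp: Jmat_def Tmat_def intmat_blocks intro: intmat_uminus)

text \<open>Collecting the entrywise quotients in one integral matrix turns congruences into matrix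
  identities, to which the distributive laws apply.\<close>

lemma congmat_iff: "congmat N g h \<longleftrightarrow> (\<exists>k. intmat k \<and> g - h = of_int N *\<^sub>R k)"
proof
  assume "congmat N g h"
  then obtain k :: "_ \<Rightarrow> _ \<Rightarrow> int" where k: "g $ i $ j - h $ i $ j = of_int (N * k i j)" for i j
    unfolding congmat_def by metis
  show "\<exists>k. intmat k \<and> g - h = of_int N *\<^sub>R k"
    by (rule exI[of _ "\<chi> i j. of_int (k i j)"]) (simp add: intmat_def vec_eq_iff k)
next
  assume "\<exists>k. intmat k \<and> g - h = of_int N *\<^sub>R k"
  then obtain k where k: "intmat k" "g - h = of_int N *\<^sub>R k" by blast
  show "congmat N g h" unfolding congmat_def
  proof (intro allI)
    fix i j
    from k(1) obtain l where "k $ i $ j = of_int l" unfolding intmat_def by (metis Ints_cases)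
    moreover have "g $ i $ j - h $ i $ j = of_int N * k $ i $ j"
      using k(2) by (metis vector_minus_component vector_scaleR_component real_scaleR_def)
    ultimately show "\<exists>k. g $ i $ j - h $ i $ j = of_int (N * k)" by auto
  qed
qed

lemma congmat_refl [simp]: "congmat N g g"
  by (force simp: congmat_iff)

lemma congmat_sym: "congmat N g h \<Longrightarrow> congmat N h g"
  by (metis congmat_iff intmat_uminus minus_diff_eq scaleR_minus_right)

lemma congmat_trans: "congmat N g h \<Longrightarrow> congmat N h k \<Longrightarrow> congmat N g k"
proof -
  assume "congmat N g h" "congmat N h k"
  then obtain u v where "intmat u" "g - h = of_int N *\<^sub>R u" "intmat v" "h - k = of_int N *\<^sub>R v"
    unfolding congmat_iff by blast
  then have "intmat (u + v)" "g - k = of_int N *\<^sub>R (u + v)"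
    by (simp_all add: intmat_add scaleR_add_right algebra_simps)
  then show ?thesis unfolding congmat_iff by blast
qed

lemma congmat_mult_left:
  assumes "congmat N g h" "intmat k" shows "congmat N (k ** g) (k ** h)"
proof -
  obtain u where u: "intmat u" "g - h = of_int N *\<^sub>R u"
    using assms(1) unfolding congmat_iff by blast
  then have "k ** g - k ** h = of_int N *\<^sub>R (k ** u)"
    by (simp add: matrix_scalar_ac scalar_matrix_assoc flip: matrix_diff_ldistrib)
  then show ?thesis unfolding congmat_iff using intmat_mult[OF assms(2) u(1)] by blast
qed

lemma congmat_mult_right:
  assumes "congmat N g h" "intmat k" shows "congmat N (g ** k) (h ** k)"
proof -
  obtain u where u: "intmat u" "g - h = of_int N *\<^sub>R u"
    using assms(1) unfolding congmat_iff by blast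
  then have "g ** k - h ** k = of_int N *\<^sub>R (u ** k)"
    by (simp add: scalar_matrix_assoc flip: matrix_diff_rdistrib)
  then show ?thesis unfolding congmat_iff using intmat_mult[OF u(1) assms(2)] by blast
qed

text \<open>The chain passes through \<open>g' ** h\<close>; integrality is asked of the factor kept
  fixed at each of the two stages.\<close>

lemma congmat_mult:
  "congmat N g g' \<Longrightarrow> congmat N h h' \<Longrightarrow> intmat g' \<Longrightarrow> intmat h \<Longrightarrow> congmat N (g ** h) (g' ** h')"
  using congmat_trans[OF congmat_mult_right[of N g g' h] congmat_mult_left[of N h h' g']] by simp

lemma congmat_dvd: "congmat N g h \<Longrightarrow> M dvd N \<Longrightarrow> congmat M g h"
  unfolding congmat_def by (metis dvdE mult.assoc)

lemma congmat_transpose: "congmat N g h \<Longrightarrow> congmat N (transpose g) (transpose h)"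
  unfolding congmat_def transpose_def by auto

lemma congmat_blocks:
  "congmat N (blocks A B C D) (blocks A' B' C' D') \<longleftrightarrow>
     congmat N A A' \<and> congmat N B B' \<and> congmat N C C' \<and> congmat N D D'"
  by (auto simp: congmat_def all_sum_iff)

lemma congmat_tauM: "congmat N g h \<Longrightarrow> congmat N (tauM g) (tauM h)"
  by (simp add: tauM_eq_conj congmat_mult_left congmat_mult_right)

section \<open>Symplectic congruence subgroups\<close>

lemma SpZ_Sp: "g \<in> SpZ \<Longrightarrow> g \<in> Sp" and SpZ_int: "g \<in> SpZ \<Longrightarrow> intmat g"
  by (auto simp: SpZ_def)

lemma SpZ_1 [simp]: "mat 1 \<in> SpZ" by (simp add: SpZ_def)

lemma SpZ_mult: "g \<in> SpZ \<Longrightarrow> h \<in> SpZ \<Longrightarrow> g ** h \<in> SpZ"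
  by (simp add: SpZ_def Sp_mult intmat_mult)

lemma SpZ_inv: "g \<in> SpZ \<Longrightarrow> matrix_inv g \<in> SpZ"
  by (simp add: SpZ_def Sp_matrix_inv)
     (simp add: Sp_inv Spinv_def intmat_mult intmat_transpose intmat_uminus)

lemma SpZ_tauM: "g \<in> SpZ \<Longrightarrow> tauM g \<in> SpZ"
  by (simp add: SpZ_def Sp_tauM) (simp add: tauM_eq_conj intmat_mult)

text \<open>On \<open>Sp\<close> inversion agrees with the linear map \<open>Spinv\<close>, which
  respects congruences because \<open>Jmat\<close> is integral.\<close>

lemma congmat_inv:
  assumes "g \<in> SpZ" "h \<in> SpZ" "congmat N g h"
  shows "congmat N (matrix_inv g) (matrix_inv h)"
proof -
  have "congmat N ((- Jmat) ** transpose g ** Jmat) ((- Jmat) ** transpose h ** Jmat)"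
    using assms(3) by (intro congmat_mult_left congmat_mult_right congmat_transpose intmat_uminus intmat_Jmat)
  then show ?thesis using assms by (simp add: SpZ_def Sp_inv Spinv_def)
qed

lemma Gam_SpZ: "g \<in> Gam N \<Longrightarrow> g \<in> SpZ" by (simp add: Gam_def)

lemma Gam_1 [simp]: "mat 1 \<in> Gam N" by (simp add: Gam_def)

lemma Gam_mult: "g \<in> Gam N \<Longrightarrow> h \<in> Gam N \<Longrightarrow> g ** h \<in> Gam N"
  using congmat_mult[of N g "mat 1" h "mat 1"] by (simp add: Gam_def SpZ_mult SpZ_int)

lemma Gam_inv: "g \<in> Gam N \<Longrightarrow> matrix_inv g \<in> Gam N"
  using congmat_inv[of g "mat 1" N] by (simp add: Gam_def SpZ_inv matrix_inv_eqI)

lemma Gam_tauM: "g \<in> Gam N \<Longrightarrow> tauM g \<in> Gam N"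
  using congmat_tauM[of N g "mat 1"] by (simp add: Gam_def SpZ_tauM)

lemma Gam_conj:
  assumes "g \<in> Gam N" "h \<in> SpZ" shows "h ** g ** matrix_inv h \<in> Gam N"
proof -
  have "congmat N (h ** g ** matrix_inv h) (h ** mat 1 ** matrix_inv h)"
    using assms by (intro congmat_mult_left congmat_mult_right) (auto simp: Gam_def SpZ_int SpZ_inv)
  then show ?thesis using assms
    by (simp add: Gam_def SpZ_mult SpZ_inv Sp_inv_right SpZ_Sp)
qed

lemma Gam_conj':
  assumes "g \<in> Gam N" "h \<in> SpZ" shows "matrix_inv h ** g ** h \<in> Gam N"
  using Gam_conj[OF assms(1) SpZ_inv[OF assms(2)]] assms(2) by (simp add: matrix_inv_matrix_inv_Sp SpZ_Sp)

lemma Gam_quotI: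
  assumes "g \<in> SpZ" "h \<in> SpZ" "congmat N g h"
  shows "g ** matrix_inv h \<in> Gam N" "matrix_inv h ** g \<in> Gam N"
proof -
  have "congmat N (g ** matrix_inv h) (h ** matrix_inv h)" "congmat N (matrix_inv h ** g) (matrix_inv h ** h)"
    using assms by (auto intro!: congmat_mult_left congmat_mult_right simp: SpZ_int SpZ_inv)
  then show "g ** matrix_inv h \<in> Gam N" "matrix_inv h ** g \<in> Gam N" using assms
    by (simp_all add: Gam_def SpZ_mult SpZ_inv Sp_inv_right Sp_inv_left SpZ_Sp)
qed

text \<open>In this form the group laws are immediate, since \<open>tauM\<close> is multiplicative.\<close>

lemma
  shows Gam2m2_iff_blk: "g \<in> Gam2m2 m \<longleftrightarrow>
      g \<in> SpZ \<and> congmat 2 (blkA g) (mat 1) \<and> congmat 2 (blkD g) (mat 1) \<and> congmat (4*m) (tauM g) g"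
    and Gam2m2_iff: "g \<in> Gam2m2 m \<longleftrightarrow> g \<in> SpZ \<and> congmat 2 g (mat 1) \<and> congmat (4*m) (tauM g) g"
proof -
  obtain A B C D where g: "g = blocks A B C D" by (metis blocks_blk)
  \<comment> \<open>The difference is \<open>- 2 X\<close>, so its divisibility by
    \<open>4*m\<close> is divisibility of \<open>X\<close> by \<open>2*m\<close>: this is how
    \<tau>(g) \<equiv> g encodes the condition on the off-diagonal blocks. The quotient changes sign
    on the way.\<close>
  have eq: "congmat (4*m) (-X) X \<longleftrightarrow> congmat (2*m) X 0" for X :: "real^'a^'a"
  proof -
    have *: "- x - x = of_int (4*m*k) \<longleftrightarrow> x - 0 = of_int (2*m*(-k))" for x :: real and k
    proof -
      have "of_int (4*m*k) = 4 * (of_int (m*k) :: real)" "of_int (2*m*(-k)) = - 2 * (of_int (m*k) :: real)"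
        by simp_all
      then show ?thesis by linarith
    qed
    have "(\<exists>k::int. - x - x = of_int (4*m*k)) \<longleftrightarrow> (\<exists>k::int. x - 0 = of_int (2*m*k))" for x :: real
      unfolding * by (metis minus_minus)
    then show ?thesis by (simp only: congmat_def vector_uminus_component zero_index)
  qed
  have d: "congmat (2*m) X 0 \<Longrightarrow> congmat 2 X 0" for X :: "real^'a^'a"
    by (rule congmat_dvd) auto
  show 1: "g \<in> Gam2m2 m \<longleftrightarrow>
      g \<in> SpZ \<and> congmat 2 (blkA g) (mat 1) \<and> congmat 2 (blkD g) (mat 1) \<and> congmat (4*m) (tauM g) g"
    by (auto simp: Gam2m2_def g tauM_def congmat_blocks eq)
  show "g \<in> Gam2m2 m \<longleftrightarrow> g \<in> SpZ \<and> congmat 2 g (mat 1) \<and> congmat (4*m) (tauM g) g"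
    unfolding 1 by (auto simp: g tauM_def mat_1_eq_blocks congmat_blocks eq d)
qed

lemma Gam2m2_SpZ: "g \<in> Gam2m2 m \<Longrightarrow> g \<in> SpZ" by (simp add: Gam2m2_def)

lemma Gam2m2_mult: "g \<in> Gam2m2 m \<Longrightarrow> h \<in> Gam2m2 m \<Longrightarrow> g ** h \<in> Gam2m2 m"
  using congmat_mult[of 2 g "mat 1" h "mat 1"]
  by (simp add: Gam2m2_iff SpZ_mult SpZ_int tauM_mult congmat_mult SpZ_tauM)

lemma Gam2m2_inv: "g \<in> Gam2m2 m \<Longrightarrow> matrix_inv g \<in> Gam2m2 m"
  using congmat_inv[of g "mat 1" 2] congmat_inv[of "tauM g" g "4*m"]
  by (simp add: Gam2m2_iff SpZ_inv SpZ_tauM matrix_inv_eqI matrix_inv_tauM SpZ_Sp)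

lemma Gam2m2_tauM: "g \<in> Gam2m2 m \<Longrightarrow> tauM g \<in> Gam2m2 m"
  using congmat_tauM[of 2 g "mat 1"] congmat_sym[of "4*m" "tauM g" g] by (simp add: Gam2m2_iff SpZ_tauM)

lemma Gam_subset_Gam2m2: "g \<in> Gam (4*m) \<Longrightarrow> g \<in> Gam2m2 m"
  using congmat_tauM[of "4*m" g "mat 1"] congmat_trans[of "4*m" "tauM g" "mat 1" g]
    congmat_sym[of "4*m" g "mat 1"] congmat_dvd[of "4*m" g "mat 1" 2]
  by (simp add: Gam2m2_iff Gam_def)

lemma Gam2m2_quot_Gam:
  assumes "g \<in> Gam2m2 m"
  shows "tauM g ** matrix_inv g \<in> Gam (4*m)" "matrix_inv g ** tauM g \<in> Gam (4*m)"
  using assms Gam_quotI[of "tauM g" g "4*m"] by (auto simp: Gam2m2_iff SpZ_tauM)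

text \<open>The off-diagonal blocks of a \<tau>-fixed matrix equal their negatives, hence vanish;
  the symplectic relation then reads \<open>transpose A ** D = mat 1\<close> and makes
  \<open>D\<close> the inverse transpose of \<open>A\<close>. Membership in the embedded linear
  group becomes a fixed-point condition.\<close>

lemma Gaml_iff: "g \<in> Gaml N \<longleftrightarrow> g \<in> SpZ \<and> tauM g = g \<and> congmat N (blkA g) (mat 1)"
proof
  assume "g \<in> Gaml N"
  then obtain A where A: "g = blocks A 0 0 (transpose (matrix_inv A))" "intmat A" "invertible A"
     "intmat (matrix_inv A)" "congmat N A (mat 1)"
    by (auto simp: Gaml_def GLZ_def embGL_def)
  have "transpose A ** transpose (matrix_inv A) = mat 1"  "matrix_inv A ** A = mat 1"
    using A(3) by (simp_all flip: matrix_transpose_mul add: matrix_inv_left)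
  then have "g \<in> Sp" by (simp add: Sp_def A(1) Jmat_def transpose_blocks blocks_mult)
  then show "g \<in> SpZ \<and> tauM g = g \<and> congmat N (blkA g) (mat 1)"
    using A by (auto simp: SpZ_def intmat_blocks intmat_transpose tauM_def)
next
  assume r: "g \<in> SpZ \<and> tauM g = g \<and> congmat N (blkA g) (mat 1)"
  obtain A B C D where g: "g = blocks A B C D" by (metis blocks_blk)
  have "- B = B" "- C = C" using r by (simp_all add: g tauM_def)
  then have BC: "B = 0" "C = 0" by (simp_all add: vec_eq_iff)
  have i: "intmat A" "intmat D" using r by (auto simp: SpZ_def g intmat_blocks)
  have "transpose A ** D = mat 1" using r by (auto simp: SpZ_def Sp_def g BC Jmat_def transpose_blocks blocks_mult)
  then have "transpose D ** A = mat 1" by (metis matrix_transpose_mul transpose_mat transpose_transpose)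
  then have "A ** transpose D = mat 1" "invertible A" by (auto simp: matrix_left_right_inverse invertible_left_inverse)
  then have "matrix_inv A = transpose D" by (simp add: matrix_inv_eqI)
  then show "g \<in> Gaml N" using r i \<open>invertible A\<close>
    by (auto simp: Gaml_def GLZ_def embGL_def g BC intmat_transpose intro!: image_eqI[of _ _ A])
qed

text \<open>Multiplying A \<equiv> 1 by the integral inverse of \<open>A\<close> gives the
  congruence for \<open>matrix_inv A\<close>, and transposing gives it for the lower block.\<close>

lemma Gaml_in_Gam:
  assumes "g \<in> SpZ" "tauM g = g"
  shows "g \<in> Gaml N \<longleftrightarrow> g \<in> Gam N"
proof
  assume "g \<in> Gam N" then show "g \<in> Gaml N" using assms
    by (simp add: Gaml_iff Gam_def) (metis blk_blocks(1) blocks_blk congmat_blocks mat_1_eq_blocks)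
next
  assume "g \<in> Gaml N"
  then obtain A where A: "g = blocks A 0 0 (transpose (matrix_inv A))" "intmat A" "invertible A"
     "intmat (matrix_inv A)" "congmat N A (mat 1)"
    by (auto simp: Gaml_def GLZ_def embGL_def)
  have "congmat N (matrix_inv A ** A) (matrix_inv A ** mat 1)" using A by (intro congmat_mult_left)
  then have "congmat N (matrix_inv A) (mat 1)" using A(3) by (simp add: matrix_inv_left congmat_sym)
  then have "congmat N (transpose (matrix_inv A)) (mat 1)" using congmat_transpose by fastforce
  then show "g \<in> Gam N" using assms A by (simp add: Gam_def mat_1_eq_blocks congmat_blocks)
qed

subsection \<open>The action on the Siegel space\<close>

lemma cplx_mult: "cplx (A ** B) = cplx A ** cplx B"
  by (simp add: cplx_def vec_eq_iff matrix_matrix_mult_def)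

lemma cplx_uminus: "cplx (- A) = - cplx A"
  by (simp add: cplx_def vec_eq_iff)

lemma cplx_0 [simp]: "cplx 0 = 0"
  by (simp add: cplx_def vec_eq_iff)

lemma cplx_mat_1 [simp]: "cplx (mat 1) = mat 1"
  by (simp add: cplx_def vec_eq_iff mat_def)

lemma cplx_transpose: "cplx (transpose A) = transpose (cplx A)"
  by (simp add: cplx_def vec_eq_iff transpose_def)

definition cnjM :: "complex^'n^'m \<Rightarrow> complex^'n^'m" where
  "cnjM M = (\<chi> i j. cnj (M $ i $ j))"

lemma cnjM_mult: "cnjM (A ** B) = cnjM A ** cnjM B"
  by (simp add: cnjM_def vec_eq_iff matrix_matrix_mult_def)

lemma cnjM_cplx [simp]: "cnjM (cplx A) = cplx A"
  by (simp add: cnjM_def cplx_def vec_eq_iff)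

lemma cnjM_mat_1 [simp]: "cnjM (mat 1) = mat 1"
  by (simp add: cnjM_def mat_def vec_eq_iff)

lemma tauZ_eq: "tauZ Z = - cnjM Z"
  by (simp add: tauZ_def cnjM_def vec_eq_iff)

lemma tauZ_tauZ [simp]: "tauZ (tauZ Z) = Z"
  by (simp add: tauZ_def vec_eq_iff)

lemma cplx_mult_stack:
  "cplx g ** stack P Q =
    stack (cplx (blkA g) ** P + cplx (blkB g) ** Q) (cplx (blkC g) ** P + cplx (blkD g) ** Q)"
  by (simp add: vec_eq_iff all_sum_iff matrix_matrix_mult_def sum_UNIV_Plus cplx_def
      blkA_def blkB_def blkC_def blkD_def)

lemma cnjM_stack: "cnjM (stack P Q) = stack (cnjM P) (cnjM Q)"
  by (simp add: vec_eq_iff all_sum_iff cnjM_def)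

lemma stack_Jmat_stack:
  "transpose (stack P Q) ** (cplx Jmat ** stack P' Q') = transpose P ** Q' - transpose Q ** P'"
  unfolding cplx_mult_stack Jmat_def
  by (simp add: cplx_uminus)
     (simp add: vec_eq_iff matrix_matrix_mult_def transpose_def sum_UNIV_Plus sum_negf)

text \<open>Complexification turns the defining relation of \<open>Sp\<close> into invariance of a
  complex bilinear form, which can then be evaluated at \<open>stack Z (mat 1)\<close> and at its
  conjugate.\<close>

lemma Sp_cplx_form:
  assumes "g \<in> Sp"
  shows "transpose (cplx g ** S) ** (cplx Jmat ** (cplx g ** S')) = transpose S ** (cplx Jmat ** S')"
proof -
  have "transpose (cplx g) ** cplx Jmat ** cplx g = cplx (transpose g ** Jmat ** g)"
    by (simp add: cplx_mult cplx_transpose)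
  also have "\<dots> = cplx Jmat" using assms by (simp add: Sp_def)
  finally have *: "transpose (cplx g) ** cplx Jmat ** cplx g = cplx Jmat" .
  have "transpose (cplx g ** S) ** (cplx Jmat ** (cplx g ** S'))
      = transpose S ** (transpose (cplx g) ** cplx Jmat ** cplx g) ** S'"
    by (simp only: matrix_transpose_mul matrix_mul_assoc)
  then show ?thesis unfolding * by (simp only: matrix_mul_assoc)
qed

section \<open>The Hermitian form of the imaginary part\<close>

definition sesq :: "complex^'n \<Rightarrow> complex^'n \<Rightarrow> complex" where
  "sesq u v = (\<Sum>i\<in>UNIV. cnj (u $ i) * v $ i)"

definition Rev :: "complex^'n \<Rightarrow> real^'n" where "Rev w = (\<chi> i. Re (w $ i))"
definition Imv :: "complex^'n \<Rightarrow> real^'n" where "Imv w = (\<chi> i. Im (w $ i))"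

text \<open>For symmetric \<open>Y\<close> this is the Hermitian form of \<open>Y\<close> at
  \<open>w\<close>, split into real and imaginary parts so that positivity of \<open>Y\<close> over
  the reals applies directly.\<close>

definition hq :: "real^'n^'n \<Rightarrow> complex^'n \<Rightarrow> real" where
  "hq Y w = Rev w \<bullet> (Y *v Rev w) + Imv w \<bullet> (Y *v Imv w)"

lemma sesq_adjoint: "sesq u ((transpose (cnjM A) ** B) *v v) = sesq (A *v u) (B *v v)"
proof -
  have *: "(transpose (cnjM A) *v x) $ i = (\<Sum>k\<in>UNIV. cnj (A $ k $ i) * x $ k)" for x i
    by (simp only: matrix_vector_mult_def transpose_def cnjM_def vec_lambda_beta)
  have "sesq u ((transpose (cnjM A) ** B) *v v)
      = (\<Sum>i\<in>UNIV. \<Sum>k\<in>UNIV. cnj (A $ k $ i) * cnj (u $ i) * (B *v v) $ k)"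
    unfolding matrix_vector_mul_assoc[symmetric]
    by (simp add: sesq_def * sum_distrib_left mult_ac del: transpose_matrix_vector)
  also have "\<dots> = (\<Sum>k\<in>UNIV. \<Sum>i\<in>UNIV. cnj (A $ k $ i) * cnj (u $ i) * (B *v v) $ k)"
    by (rule sum.swap)
  also have "\<dots> = sesq (A *v u) (B *v v)"
    by (simp add: sesq_def matrix_vector_mult_def[of A] sum_distrib_right)
  finally show ?thesis .
qed

lemma sesq_diff_right: "sesq u (v - w) = sesq u v - sesq u w"
  by (simp add: sesq_def right_diff_distrib sum_subtractf)

text \<open>The matrix \<open>cnjM W - W\<close> is -2i times the imaginary part of
  \<open>W\<close>, and the cross terms between \<open>Rev w\<close> and \<open>Imv w\<close> cancel
  because that part is symmetric.\<close>

lemma sesq_Im: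
  assumes "transpose W = W"
  shows "sesq w ((cnjM W - W) *v w) = - 2 * \<i> * of_real (hq (ImM W) w)"
proof -
  let ?Y = "ImM W"
  let ?a = "\<lambda>i. Re (w $ i)" and ?b = "\<lambda>i. Im (w $ i)"
  have sym: "?Y $ i $ j = ?Y $ j $ i" for i j
    using assms by (metis (mono_tags) ImM_def transpose_def vec_lambda_beta)
  have "(cnjM W - W) $ i $ j = - 2 * \<i> * of_real (?Y $ i $ j)" for i j
    by (simp add: cnjM_def ImM_def complex_eq_iff)
  then have "sesq w ((cnjM W - W) *v w)
      = (\<Sum>i\<in>UNIV. \<Sum>j\<in>UNIV. - 2 * \<i> * (of_real (?Y $ i $ j) * (cnj (w $ i) * w $ j)))"
    unfolding sesq_def matrix_vector_mult_def by (simp add: sum_distrib_left mult_ac)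
  also have "\<dots> = - 2 * \<i> * (\<Sum>i\<in>UNIV. \<Sum>j\<in>UNIV. of_real (?Y $ i $ j) * (cnj (w $ i) * w $ j))"
    by (simp add: sum_distrib_left)
  also have "(\<Sum>i\<in>UNIV. \<Sum>j\<in>UNIV. of_real (?Y $ i $ j) * (cnj (w $ i) * w $ j)) = of_real (hq ?Y w)"
  proof (rule complex_eqI)
    show "Re (\<Sum>i\<in>UNIV. \<Sum>j\<in>UNIV. of_real (?Y $ i $ j) * (cnj (w $ i) * w $ j)) = Re (of_real (hq ?Y w))"
      by (simp add: hq_def inner_vec_def matrix_vector_mult_def Rev_def Imv_def sum_distrib_left
          sum.distrib[symmetric] algebra_simps)
    have "(\<Sum>i\<in>UNIV. \<Sum>j\<in>UNIV. ?Y $ i $ j * (?b i * ?a j)) = (\<Sum>i\<in>UNIV. \<Sum>j\<in>UNIV. ?Y $ i $ j * (?a i * ?b j))"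
      by (subst sum.swap) (simp add: sym[of _ _] mult.commute)
    then show "Im (\<Sum>i\<in>UNIV. \<Sum>j\<in>UNIV. of_real (?Y $ i $ j) * (cnj (w $ i) * w $ j)) = Im (of_real (hq ?Y w))"
      by (simp add: right_diff_distrib sum_subtractf)
  qed
  finally show ?thesis .
qed

lemma hq_pos: assumes "posdef Y" "w \<noteq> 0" shows "hq Y w > 0"
proof -
  have nn: "x \<bullet> (Y *v x) \<ge> 0" for x
    using assms(1) by (cases "x = 0") (auto simp: posdef_def less_imp_le)
  have "Rev w \<noteq> 0 \<or> Imv w \<noteq> 0"
    using assms(2) by (auto simp: vec_eq_iff Rev_def Imv_def complex_eq_iff)
  then show ?thesis
    using assms(1) nn[of "Rev w"] nn[of "Imv w"] unfolding hq_def posdef_def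
    by (metis add_nonneg_pos add_pos_nonneg)
qed

section \<open>Fractional linear action through homogeneous coordinates\<close>

definition num :: "'n::finite smat \<Rightarrow> complex^'n^'n \<Rightarrow> complex^'n^'n" where
  "num g Z = cplx (blkA g) ** Z + cplx (blkB g)"
definition den :: "'n::finite smat \<Rightarrow> complex^'n^'n \<Rightarrow> complex^'n^'n" where
  "den g Z = cplx (blkC g) ** Z + cplx (blkD g)"

lemma cplx_stack_num_den: "cplx g ** stack Z (mat 1) = stack (num g Z) (den g Z)"
  by (simp add: cplx_mult_stack num_def den_def)

text \<open>Both identities are the invariance of the symplectic form on the columns of
  \<open>stack Z (mat 1)\<close>, paired with themselves and with their conjugates. The first
  controls symmetry of the image point, the second positivity.\<close>

lemma den_form:
  assumes "g \<in> Sp"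
  shows "transpose (num g Z) ** den g Z - transpose (den g Z) ** num g Z = transpose Z - Z"
    and "transpose (cnjM (num g Z)) ** den g Z - transpose (cnjM (den g Z)) ** num g Z = transpose (cnjM Z) - Z"
proof -
  show "transpose (num g Z) ** den g Z - transpose (den g Z) ** num g Z = transpose Z - Z"
    using Sp_cplx_form[OF assms, of "stack Z (mat 1)" "stack Z (mat 1)"]
    unfolding cplx_stack_num_den[of g] stack_Jmat_stack by simp
  have "cplx g ** cnjM (stack Z (mat 1)) = cnjM (cplx g ** stack Z (mat 1))"
    by (simp add: cnjM_mult)
  then have "cplx g ** cnjM (stack Z (mat 1)) = stack (cnjM (num g Z)) (cnjM (den g Z))"
    unfolding cplx_stack_num_den cnjM_stack .
  then show "transpose (cnjM (num g Z)) ** den g Z - transpose (cnjM (den g Z)) ** num g Z = transpose (cnjM Z) - Z"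
    using Sp_cplx_form[OF assms, of "cnjM (stack Z (mat 1))" "stack Z (mat 1)"]
    unfolding cplx_stack_num_den[of g] cnjM_stack stack_Jmat_stack by (simp add: stack_Jmat_stack)
qed

lemma transpose_cnjM: "transpose (cnjM Z) = cnjM (transpose Z)"
  by (simp add: vec_eq_iff transpose_def cnjM_def)

text \<open>A kernel vector of the denominator kills the left side of the second identity in
  \<open>den_form\<close>, so the Hermitian form of the imaginary part of \<open>Z\<close> would
  vanish there, against positivity.\<close>

lemma den_invertible:
  assumes "g \<in> Sp" "Z \<in> siegel" shows "invertible (den g Z)"
proof -
  have Z: "transpose Z = Z" "posdef (ImM Z)" using assms(2) by (auto simp: siegel_def)
  have "w = 0" if "den g Z *v w = 0" for w
  proof (rule ccontr)
    assume "w \<noteq> 0"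
    have "sesq w ((cnjM Z - Z) *v w) = sesq (num g Z *v w) (den g Z *v w) - sesq (den g Z *v w) (num g Z *v w)"
      unfolding sesq_adjoint[symmetric] sesq_diff_right[symmetric] matrix_vector_mult_diff_rdistrib[symmetric]
        den_form(2)[OF assms(1)] by (simp add: transpose_cnjM Z(1))
    also have "\<dots> = 0" by (simp add: that sesq_def)
    finally show False using hq_pos[OF Z(2) \<open>w \<noteq> 0\<close>] by (simp add: sesq_Im Z(1))
  qed
  then show ?thesis by (simp add: invertible_left_inverse matrix_left_invertible_ker)
qed

text \<open>The columns of \<open>stack Z (mat 1)\<close> span a Lagrangian subspace;
  \<open>g\<close> moves it to the one of \<open>act g Z\<close>, and \<open>den g Z\<close> is the
  change of basis.\<close>

lemma cplx_stack_act:
  assumes "g \<in> Sp" "Z \<in> siegel"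
  shows "cplx g ** stack Z (mat 1) = stack (act g Z) (mat 1) ** den g Z"
proof -
  have "act g Z ** den g Z = num g Z"
    using matrix_inv_left[OF den_invertible[OF assms]]
    by (simp add: act_def num_def den_def flip: matrix_mul_assoc)
  then show ?thesis by (simp add: cplx_stack_num_den stack_mult)
qed

text \<open>The lower block of the equation forces \<open>K\<close> to be \<open>den g Z\<close>,
  and the upper block then determines \<open>W\<close> by invertibility of the denominator.\<close>

lemma act_eqI:
  assumes "g \<in> Sp" "Z \<in> siegel" "cplx g ** stack Z (mat 1) = stack W (mat 1) ** K"
  shows "act g Z = W"
proof -
  have "num g Z = W ** den g Z"
    using assms(3) by (simp add: cplx_stack_num_den stack_mult)
  then have "act g Z = W ** (den g Z ** matrix_inv (den g Z))"
    by (simp add: act_def num_def den_def matrix_mul_assoc)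
  then show ?thesis using matrix_inv_right[OF den_invertible[OF assms(1,2)]] by simp
qed

text \<open>Substituting \<open>num g Z = act g Z ** den g Z\<close> into \<open>den_form\<close>
  sandwiches \<open>transpose W - W\<close> and \<open>cnjM W - W\<close>, for
  \<open>W = act g Z\<close>, between the denominator and its transpose or adjoint. Cancelling gives
  symmetry; evaluating at a vector gives the invariance of \<open>hq\<close>.\<close>

lemma act_sym_hq:
  assumes "g \<in> Sp" "Z \<in> siegel"
  shows "transpose (act g Z) = act g Z"
    and "hq (ImM (act g Z)) (den g Z *v w) = hq (ImM Z) w"
proof -
  let ?W = "act g Z" and ?K = "den g Z"
  have Z: "transpose Z = Z" "posdef (ImM Z)" using assms(2) by (auto simp: siegel_def)
  have n: "num g Z = ?W ** ?K"
    using cplx_stack_act[OF assms] by (simp add: cplx_stack_num_den stack_mult)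
  have i: "?K ** matrix_inv ?K = mat 1" using matrix_inv_right[OF den_invertible[OF assms]] .
  then have i': "transpose (matrix_inv ?K) ** transpose ?K = mat 1"
    by (simp flip: matrix_transpose_mul)
  have "transpose ?K ** transpose ?W ** ?K = transpose ?K ** ?W ** ?K"
    using den_form(1)[OF assms(1), of Z] Z(1) by (simp add: n matrix_transpose_mul matrix_mul_assoc)
  then have "(transpose (matrix_inv ?K) ** transpose ?K) ** transpose ?W ** (?K ** matrix_inv ?K)
     = (transpose (matrix_inv ?K) ** transpose ?K) ** ?W ** (?K ** matrix_inv ?K)"
    by (simp only: matrix_mul_assoc[symmetric]) (simp only: matrix_mul_assoc)
  then show sym: "transpose ?W = ?W" by (simp add: i i')
  have "transpose (cnjM ?K) ** ((cnjM ?W - ?W) ** ?K) = cnjM Z - Z"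
    using den_form(2)[OF assms(1), of Z] Z(1) sym
    by (simp add: n cnjM_mult matrix_transpose_mul transpose_cnjM matrix_distribs matrix_mul_assoc)
  then have "sesq w ((cnjM Z - Z) *v w) = sesq (?K *v w) ((cnjM ?W - ?W) *v (?K *v w))"
    by (metis sesq_adjoint matrix_vector_mul_assoc)
  then show "hq (ImM (act g Z)) (den g Z *v w) = hq (ImM Z) w"
    by (simp add: sesq_Im sym Z(1))
qed

text \<open>Every real vector has the form \<open>den g Z *v w\<close> for some complex
  \<open>w\<close>, so positivity at it is positivity of \<open>hq (ImM Z)\<close> at
  \<open>w\<close>.\<close>

lemma act_siegel:
  assumes "g \<in> Sp" "Z \<in> siegel" shows "act g Z \<in> siegel"
proof -
  have Z: "posdef (ImM Z)" using assms(2) by (auto simp: siegel_def)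
  let ?W = "act g Z" and ?K = "den g Z"
  have sym: "transpose ?W = ?W" by (rule act_sym_hq[OF assms])
  have "x \<bullet> (ImM ?W *v x) > 0" if "x \<noteq> 0" for x
  proof -
    define v :: "complex^'a" where "v = (\<chi> i. of_real (x $ i))"
    define w where "w = matrix_inv ?K *v v"
    have v: "?K *v w = v"
      using matrix_inv_right[OF den_invertible[OF assms]] by (simp add: w_def matrix_vector_mul_assoc)
    have "v \<noteq> 0" using that by (simp add: v_def vec_eq_iff)
    then have "w \<noteq> 0" using v by auto
    have "hq (ImM ?W) v = x \<bullet> (ImM ?W *v x)"
    proof -
      have "Rev v = x" "Imv v = 0" by (simp_all add: v_def Rev_def Imv_def vec_eq_iff)
      then show ?thesis by (simp add: hq_def)
    qed
    then show ?thesis using act_sym_hq(2)[OF assms, of w] hq_pos[OF Z \<open>w \<noteq> 0\<close>] v by simp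
  qed
  moreover have "transpose (ImM ?W) = ImM ?W"
    using sym by (simp add: ImM_def transpose_def vec_eq_iff)
  ultimately show ?thesis using sym by (simp add: siegel_def posdef_def)
qed

lemma act_1 [simp]: "act (mat 1) Z = Z"
proof -
  have "blkA (mat 1 :: 'a smat) = mat 1" "blkB (mat 1 :: 'a smat) = 0" "blkC (mat 1 :: 'a smat) = 0"
     "blkD (mat 1 :: 'a smat) = mat 1" by (simp_all add: mat_1_eq_blocks)
  moreover have "matrix_inv (mat 1 :: complex^'a^'a) = mat 1" by (rule matrix_inv_eqI) simp
  ultimately show ?thesis by (simp add: act_def)
qed

text \<open>Applying \<open>g\<close> and \<open>h\<close> in turn to homogeneous coordinates
  multiplies the denominators, and \<open>act_eqI\<close> reads off the resulting point.\<close>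

lemma act_mult:
  assumes "g \<in> Sp" "h \<in> Sp" "Z \<in> siegel" shows "act (g ** h) Z = act g (act h Z)"
proof (rule act_eqI)
  have "cplx (g ** h) ** stack Z (mat 1) = cplx g ** (cplx h ** stack Z (mat 1))"
    by (simp add: cplx_mult matrix_mul_assoc)
  also have "\<dots> = cplx g ** stack (act h Z) (mat 1) ** den h Z"
    by (simp add: cplx_stack_act assms matrix_mul_assoc)
  also have "\<dots> = stack (act g (act h Z)) (mat 1) ** (den g (act h Z) ** den h Z)"
    by (simp add: cplx_stack_act assms act_siegel matrix_mul_assoc)
  finally show "cplx (g ** h) ** stack Z (mat 1) = stack (act g (act h Z)) (mat 1) ** (den g (act h Z) ** den h Z)" .
qed (use assms in \<open>auto intro: Sp_mult\<close>)

lemma tauZ_siegel: "Z \<in> siegel \<Longrightarrow> tauZ Z \<in> siegel"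
proof -
  assume Z: "Z \<in> siegel"
  have "ImM (tauZ Z) = ImM Z" by (simp add: ImM_def tauZ_def vec_eq_iff)
  moreover have "transpose (tauZ Z) = tauZ Z" using Z by (simp add: tauZ_eq transpose_cnjM siegel_def)
  ultimately show ?thesis using Z by (simp add: siegel_def)
qed

lemma tauZ_act:
  assumes "g \<in> Sp" "Z \<in> siegel" shows "tauZ (act g Z) = act (tauM g) (tauZ Z)"
proof (rule sym, rule act_eqI)
  let ?T = "cplx Tmat :: complex^('a+'a)^('a+'a)"
  \<comment> \<open>In homogeneous coordinates \<tau> is complex conjugation followed by
    \<open>Tmat\<close>, up to sign; conjugation commutes with the real matrix
    \<open>g\<close>.\<close>
  have T: "?T ** stack (cnjM X) (mat 1) = - stack (tauZ X) (mat 1)" for X :: "complex^'a^'a"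
    by (simp add: cplx_mult_stack Tmat_def cplx_uminus tauZ_eq stack_uminus)
  have TT: "?T ** ?T = mat 1" by (simp flip: cplx_mult)
  have "cnjM (cplx g ** stack Z (mat 1)) = cnjM (stack (act g Z) (mat 1) ** den g Z)"
    by (simp add: cplx_stack_act assms)
  then have e: "cplx g ** stack (cnjM Z) (mat 1) = stack (cnjM (act g Z)) (mat 1) ** cnjM (den g Z)"
    by (simp add: cnjM_mult cnjM_stack)
  have "cplx (tauM g) ** stack (tauZ Z) (mat 1) = - (?T ** cplx g ** (?T ** ?T) ** stack (cnjM Z) (mat 1))"
    by (simp add: tauM_eq_conj cplx_mult T flip: matrix_mul_assoc)
  also have "\<dots> = - (?T ** stack (cnjM (act g Z)) (mat 1) ** cnjM (den g Z))"
    by (simp add: TT e flip: matrix_mul_assoc)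
  also have "\<dots> = stack (tauZ (act g Z)) (mat 1) ** cnjM (den g Z)" by (simp add: T)
  finally show "cplx (tauM g) ** stack (tauZ Z) (mat 1) = stack (tauZ (act g Z)) (mat 1) ** cnjM (den g Z)" .
qed (use assms in \<open>auto intro: Sp_tauM tauZ_siegel\<close>)

subsection \<open>Stabilizers in the congruence subgroups\<close>

text \<open>The constant is the minimum of the quadratic form on the compact unit sphere; scaling
  extends the bound to all vectors.\<close>

lemma posdef_lower_bound:
  fixes Y :: "real^'n^'n"
  assumes "posdef Y" shows "\<exists>c>0. \<forall>x. c * (norm x)\<^sup>2 \<le> x \<bullet> (Y *v x)"
proof -
  let ?S = "sphere (0 :: real^'n) 1"
  have "axis undefined 1 \<in> ?S" by simp
  then have ne: "?S \<noteq> {}" by blast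
  have cont: "continuous_on ?S (\<lambda>x. x \<bullet> (Y *v x))"
    by (intro continuous_intros linear_continuous_on matrix_vector_mul_bounded_linear)
  obtain u where u: "u \<in> ?S" "\<forall>x\<in>?S. u \<bullet> (Y *v u) \<le> x \<bullet> (Y *v x)"
    using continuous_attains_inf[OF compact_sphere ne cont] by blast
  define c where "c = u \<bullet> (Y *v u)"
  have "u \<noteq> 0" using u(1) by auto
  then have "c > 0" using assms by (simp add: c_def posdef_def)
  have "c * (norm x)\<^sup>2 \<le> x \<bullet> (Y *v x)" for x
  proof (cases "x = 0")
    case False
    let ?y = "x /\<^sub>R norm x"
    have "?y \<in> ?S" using False by simp
    then have "c \<le> ?y \<bullet> (Y *v ?y)" using u(2) c_def by blast
    also have "\<dots> = x \<bullet> (Y *v x) / (norm x)\<^sup>2"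
      by (simp add: matrix_vector_mult_scaleR power2_eq_square divide_simps)
    finally show ?thesis using False by (simp add: field_simps)
  qed simp
  with \<open>c > 0\<close> show ?thesis by blast
qed

lemma posdef_invertible:
  assumes "posdef Y" shows "invertible Y"
proof -
  have "x = 0" if "Y *v x = 0" for x
    using assms that unfolding posdef_def by (metis inner_zero_right less_irrefl)
  then show ?thesis by (simp add: invertible_left_inverse matrix_left_invertible_ker)
qed

lemma norm_complex_vec: "(norm w)\<^sup>2 = (norm (Rev w))\<^sup>2 + (norm (Imv w))\<^sup>2"
  by (simp add: power2_norm_eq_inner inner_vec_def Rev_def Imv_def inner_complex_def sum.distrib)

lemma Rev_cplx: "g *v Rev u = Rev (cplx g *v u)"
  by (simp add: vec_eq_iff matrix_vector_mult_def Rev_def cplx_def)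

text \<open>A point \<open>Z\<close> identifies the real 2n-space with complex n-space; under this
  identification an element fixing \<open>Z\<close> acts through its denominator.\<close>

lemma real_vector_eq_Re_stack:
  fixes Z :: "complex^'n^'n"
  assumes "posdef (ImM Z)"
  obtains w where "x = Rev (stack Z (mat 1) *v w)"
proof -
  define a where "a = (\<chi> i. x $ Inl i)"
  define b where "b = (\<chi> i. x $ Inr i)"
  define X where "X = (\<chi> i j. Re (Z $ i $ j))"
  \<comment> \<open>Writing Z = X + iY and w = b + ic, the real part of Zw is Xb - Yc; setting it
    equal to \<open>a\<close> determines \<open>c\<close>.\<close>
  define c where "c = matrix_inv (ImM Z) *v (X *v b - a)"
  define w where "w = (\<chi> i. Complex (b $ i) (c $ i))"
  have c: "ImM Z *v c = X *v b - a"
    using matrix_inv_right[OF posdef_invertible[OF assms]] by (simp add: c_def matrix_vector_mul_assoc)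
  have "Rev (stack Z (mat 1) *v w) $ Inl i = x $ Inl i" for i
  proof -
    have "Rev (stack Z (mat 1) *v w) $ Inl i = (X *v b) $ i - (ImM Z *v c) $ i"
      by (simp add: Rev_def matrix_vector_mult_def X_def ImM_def w_def sum_subtractf)
    then show ?thesis by (simp add: c a_def)
  qed
  moreover have "Rev (stack Z (mat 1) *v w) $ Inr i = x $ Inr i" for i
  proof -
    have "(stack Z (mat 1) *v w) $ Inr i = (mat 1 *v w) $ i"
      by (simp only: matrix_vector_mult_def vec_lambda_beta stack_nth)
    then show ?thesis by (simp add: Rev_def w_def b_def)
  qed
  ultimately have "x = Rev (stack Z (mat 1) *v w)"
    by (simp add: vec_eq_iff[of x] all_sum_iff)
  then show ?thesis by (rule that)
qed

text \<open>If \<open>g\<close> fixes \<open>Z\<close>, its denominator preserves the definite form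
  \<open>hq (ImM Z)\<close>, so \<open>den g Z *v w\<close> stays in a ball independent of
  \<open>g\<close>; so does \<open>g *v x\<close>, its image under the fixed linear map
  \<open>L\<close>.\<close>

lemma stabilizer_bounded:
  assumes "Z \<in> siegel"
  obtains C where "\<And>g. g \<in> Sp \<Longrightarrow> act g Z = Z \<Longrightarrow> norm (g *v x) \<le> C"
proof -
  have Y: "posdef (ImM Z)" using assms by (simp add: siegel_def)
  obtain w where w: "x = Rev (stack Z (mat 1) *v w)" using real_vector_eq_Re_stack[OF Y] .
  define L where "L = (\<lambda>u. Rev (stack Z (mat 1) *v u))"
  have "linear Rev" by (rule linearI) (simp_all add: Rev_def vec_eq_iff)
  then have "linear L"
    using linear_compose[OF matrix_vector_mul_linear] by (simp add: L_def o_def)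
  then obtain B where B: "B > 0" "\<And>u. norm (L u) \<le> B * norm u" using linear_bounded_pos by blast
  obtain c where c: "c > 0" "\<And>v. c * (norm v)\<^sup>2 \<le> v \<bullet> (ImM Z *v v)" using posdef_lower_bound[OF Y] by blast
  have c': "c * (norm u)\<^sup>2 \<le> hq (ImM Z) u" for u
    using c(2)[of "Rev u"] c(2)[of "Imv u"] by (simp add: norm_complex_vec hq_def distrib_left)
  have "norm (g *v x) \<le> B * sqrt (hq (ImM Z) w / c)" if g: "g \<in> Sp" "act g Z = Z" for g
  proof -
    have "g *v x = L (den g Z *v w)"
      using cplx_stack_act[OF g(1) assms] g(2) by (simp add: w L_def Rev_cplx matrix_vector_mul_assoc)
    then have "norm (g *v x) \<le> B * norm (den g Z *v w)" using B(2) by simp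
    moreover have "c * (norm (den g Z *v w))\<^sup>2 \<le> hq (ImM Z) w"
      using c'[of "den g Z *v w"] act_sym_hq(2)[OF g(1) assms, of w] g(2) by simp
    then have "norm (den g Z *v w) \<le> sqrt (hq (ImM Z) w / c)"
      using c(1) by (intro real_le_rsqrt) (simp add: field_simps)
    ultimately show ?thesis using B(1) by (meson mult_left_mono less_imp_le order_trans)
  qed
  then show ?thesis by (rule that)
qed

text \<open>If the powers of \<open>g = 1 + 4 M\<close> are bounded, then \<open>M = (g - 1) / 4\<close> satisfies
  \<open>M\<^sup>k = O(2\<^sup>-\<^sup>k)\<close>, so that the integral matrix \<open>M\<close> is nilpotent; and a unipotent matrix with
  bounded powers is trivial.\<close>

lemma bounded_powers_cong_1_mod_4:
  fixes M :: "real^'m^'m"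
  defines "f \<equiv> \<lambda>x. x + 4 *\<^sub>R (M *v x)"
  assumes M: "intmat M" and bdd: "\<And>x. \<exists>C. \<forall>j. norm ((f ^^ j) x) \<le> C"
  shows "M = 0"
proof -
  define N where "N = (*v) M"
  have linN: "linear N" unfolding N_def by simp
  have linf: "linear f"
    unfolding f_def by (rule linearI) (simp_all add: algebra_simps)
  have linfj: "linear (f ^^ j)" for j
    by (induction j) (simp_all add: linear_id[unfolded id_def] linear_compose[unfolded o_def] linf o_def id_def)
  \<comment> \<open>The operator \<open>N\<close> is (f - 1)/4 and commutes with the powers of
    \<open>f\<close>. Each application turns a bound B, uniform in \<open>j\<close>, into (B + B)/4,
    which halves it.\<close>
  have decay: "norm ((f ^^ j) ((N ^^ k) x)) \<le> C / 2 ^ k" if "\<And>j. norm ((f ^^ j) x) \<le> C" for C x j k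
  proof (induction k arbitrary: j)
    case (Suc k)
    let ?y = "(N ^^ k) x"
    have "N ?y = (1/4) *\<^sub>R (f ?y - ?y)" by (simp add: f_def N_def)
    then have N: "(N ^^ Suc k) x = (1/4) *\<^sub>R (f ?y - ?y)" by simp
    have "(f ^^ Suc j) ?y = (f ^^ j) (f ?y)" by (simp only: funpow_Suc_right o_apply)
    then have "(f ^^ j) ((N ^^ Suc k) x) = (1/4) *\<^sub>R ((f ^^ Suc j) ?y - (f ^^ j) ?y)"
      by (simp only: N linear_cmul[OF linfj] linear_diff[OF linfj])
    then have "norm ((f ^^ j) ((N ^^ Suc k) x)) \<le> (1/4) * (norm ((f ^^ Suc j) ?y) + norm ((f ^^ j) ?y))"
      using norm_triangle_ineq4[of "(f ^^ Suc j) ?y" "(f ^^ j) ?y"] by simp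
    also have "\<dots> \<le> (1/4) * (C / 2 ^ k + C / 2 ^ k)" using Suc.IH[of "Suc j"] Suc.IH[of j] by simp
    finally show ?case by simp
  qed (use that in simp)
  \<comment> \<open>If \<open>N\<close> kills \<open>N y\<close>, then the powers of
    \<open>f\<close> move \<open>y\<close> linearly in \<open>j\<close> along \<open>N y\<close>,
    which is unbounded unless \<open>N y\<close> is zero.\<close>
  have nil2: "N y = 0" if NN: "N (N y) = 0" for y
  proof (rule ccontr)
    assume "N y \<noteq> 0"
    have fj: "(f ^^ j) y = y + (4 * real j) *\<^sub>R N y" for j
    proof (induction j)
      case (Suc j)
      have "f (y + (4 * real j) *\<^sub>R N y) = y + (4 * real j) *\<^sub>R N y + 4 *\<^sub>R (N y + (4 * real j) *\<^sub>R N (N y))"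
        by (simp add: f_def N_def algebra_simps)
      then show ?case using Suc NN by (simp add: algebra_simps)
    qed simp
    obtain C where C: "\<And>j. norm ((f ^^ j) y) \<le> C" using bdd by blast
    obtain j :: nat where j: "(C + norm y) / norm (N y) < real j" using reals_Archimedean2 by blast
    have "norm ((4 * real j) *\<^sub>R N y) \<le> C + norm y"
      using C[of j] norm_triangle_ineq4[of "(f ^^ j) y" y] unfolding fj by simp
    moreover have "C + norm y < real j * norm (N y)" using j \<open>N y \<noteq> 0\<close> by (simp add: field_simps)
    moreover have "0 \<le> real j * norm (N y)" by simp
    ultimately show False by simp
  qed
  \<comment> \<open>Repeated use of \<open>nil2\<close> lowers the exponent of a vanishing power
    down to 1.\<close>
  have nil: "N x = 0" if "(N ^^ k) x = 0" for x k
    using that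
  proof (induction k)
    case (Suc k)
    show ?case
    proof (cases k)
      case (Suc l)
      then have "N (N ((N ^^ l) x)) = 0" using Suc.prems by simp
      then have "(N ^^ k) x = 0" using nil2 Suc by simp
      then show ?thesis by (rule Suc.IH)
    qed (use Suc.prems in simp)
  qed (simp add: linear_0[OF linN])
  have "N (axis i 1) = 0" for i
  proof -
    let ?x = "axis i 1 :: real^'m"
    obtain C where C: "\<And>j. norm ((f ^^ j) ?x) \<le> C" using bdd by blast
    have int: "((N ^^ k) ?x) $ l \<in> \<int>" for k l
    proof (induction k arbitrary: l)
      case (Suc k)
      then show ?case using M by (auto simp: N_def matrix_vector_mult_def intmat_def intro!: Ints_sum Ints_mult)
    qed (simp add: axis_def)
    \<comment> \<open>For this \<open>k\<close> the integral vector \<open>(N ^^ k) ?x\<close> has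
      norm below 1, hence is zero.\<close>
    obtain k :: nat where k: "C < 2 ^ k" using real_arch_pow[of 2 C] by auto
    have "norm ((N ^^ k) ?x) \<le> C / 2 ^ k" using decay[OF C, of 0 k] by simp
    also have "\<dots> < 1" using k by simp
    finally have n1: "norm ((N ^^ k) ?x) < 1" .
    have "((N ^^ k) ?x) $ l = 0" for l
      using int[of k l] component_le_norm_cart[of "(N ^^ k) ?x" l] n1 Ints_nonzero_abs_less1 by force
    then have "(N ^^ k) ?x = 0" by (simp add: vec_eq_iff)
    then show ?thesis by (rule nil)
  qed
  then have "column i M = 0" for i
    by (simp add: N_def matrix_vector_mult_basis)
  then show ?thesis by (simp add: vec_eq_iff column_def)
qed

text \<open>All powers of \<open>g\<close> fix \<open>Z\<close>, so they move each vector within a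
  bounded set, while \<open>g\<close> is 1 plus 4 times an integral matrix;
  \<open>bounded_powers_cong_1_mod_4\<close> then applies.\<close>

lemma Gam_stabilizer_trivial:
  assumes g: "g \<in> Gam (4 * m)" and Z: "Z \<in> siegel" and fix_Z: "act g Z = Z"
  shows "g = mat 1"
proof -
  obtain K where K: "intmat K" "g - mat 1 = of_int (4 * m) *\<^sub>R K"
    using g unfolding Gam_def congmat_iff by blast
  define M where "M = of_int m *\<^sub>R K"
  have gM: "g = mat 1 + 4 *\<^sub>R M" using K(2) by (simp add: M_def algebra_simps)
  have "intmat M" using K(1) by (simp add: M_def intmat_def)
  have gx: "x + 4 *\<^sub>R (M *v x) = g *v x" for x
    by (simp add: gM matrix_vector_mult_add_rdistrib scaleR_matrix_vector_assoc)
  have Sp: "g \<in> Sp" using g by (simp add: Gam_def SpZ_Sp)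
  have pow: "\<exists>h\<in>Sp. act h Z = Z \<and> (\<forall>x. (((\<lambda>x. x + 4 *\<^sub>R (M *v x)) ^^ j) x) = h *v x)" for j
  proof (induction j)
    case 0
    show ?case by (rule bexI[of _ "mat 1"]) auto
  next
    case (Suc j)
    then obtain h where "h \<in> Sp" "act h Z = Z" "\<And>x. (((\<lambda>x. x + 4 *\<^sub>R (M *v x)) ^^ j) x) = h *v x" by blast
    then show ?case
      by (intro bexI[of _ "g ** h"]) (auto simp: gx act_mult Sp Z fix_Z matrix_vector_mul_assoc Sp_mult)
  qed
  have "M = 0"
  proof (rule bounded_powers_cong_1_mod_4[OF \<open>intmat M\<close>])
    fix x
    obtain C where C: "\<And>g. g \<in> Sp \<Longrightarrow> act g Z = Z \<Longrightarrow> norm (g *v x) \<le> C" using stabilizer_bounded[OF Z] by blast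
    show "\<exists>C. \<forall>j. norm (((\<lambda>x. x + 4 *\<^sub>R (M *v x)) ^^ j) x) \<le> C"
      using C pow by metis
  qed
  then show ?thesis by (simp add: gM)
qed

subsection \<open>Triviality of cocycles over \<open>Gam2m2\<close>\<close>

text \<open>The Leibniz expansion can be reduced modulo 2 term by term, so the determinant is
  congruent to that of the identity. Floors replace the real entries by integers for this
  purpose.\<close>

lemma det_cong_1_mod_2:
  fixes A :: "real^'n^'n"
  assumes "intmat A" "congmat 2 A (mat 1)"
  obtains k where "det A = of_int k" "odd k"
proof -
  define a where "a = (\<lambda>i j. \<lfloor>A $ i $ j\<rfloor>)"
  have a: "A $ i $ j = of_int (a i j)" for i j
    using assms(1) by (simp add: a_def intmat_def)
  define B where "B = (\<chi> i j. a i j)"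
  have "det A = of_int (det B)"
    by (simp add: det_def a B_def)
  moreover have "odd (det B)"
  proof -
    have e: "B $ i $ j mod 2 = (mat 1 :: int^'n^'n) $ i $ j mod 2" for i j
    proof -
      obtain k where "A $ i $ j - (mat 1 :: real^'n^'n) $ i $ j = of_int (2 * k)"
        using assms(2) unfolding congmat_def by blast
      then have "of_int (a i j - (mat 1 :: int^'n^'n) $ i $ j) = (of_int (2 * k) :: real)"
        by (simp add: a mat_def split: if_splits)
      then have "a i j - (mat 1 :: int^'n^'n) $ i $ j = 2 * k" using of_int_eq_iff by blast
      then show ?thesis by (simp add: B_def mod_eq_dvd_iff)
    qed
    have "(\<Prod>i\<in>UNIV. B $ i $ p i) mod 2 = (\<Prod>i\<in>UNIV. (mat 1 :: int^'n^'n) $ i $ p i) mod 2" for p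
      by (subst (1 2) mod_prod_eq[symmetric]) (simp only: e)
    then have "(of_int (sign p) * (\<Prod>i\<in>UNIV. B $ i $ p i)) mod 2
        = (of_int (sign p) * (\<Prod>i\<in>UNIV. (mat 1 :: int^'n^'n) $ i $ p i)) mod 2" for p
      by (intro mod_mult_cong refl)
    then have "det B mod 2 = det (mat 1 :: int^'n^'n) mod 2"
      unfolding det_def by (subst (1 2) mod_sum_eq[symmetric]) (simp only:)
    then show ?thesis by (simp add: odd_iff_mod_2_eq_one)
  qed
  ultimately show ?thesis by (rule that)
qed

lemma invertible_cong_1_mod_2:
  assumes "intmat A" "congmat 2 A (mat 1)" shows "invertible A"
  using det_cong_1_mod_2[OF assms] by (metis even_zero invertible_det_nz of_int_eq_0_iff)

text \<open>A basis of the image lattice of \<open>P\<close> which is standard modulo 2 is found by minimising the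
  determinant of the top block: if \<open>c\<close> is a non-integral coordinate of a lattice vector \<open>x\<close> with
  respect to \<open>V\<close>, then replacing \<open>v\<close>, the corresponding column of \<open>V\<close>, by \<open>v + 2 (x - \<lceil>c\<rceil> v)\<close>
  multiplies the determinant by \<open>1 + 2 (c - \<lceil>c\<rceil>)\<close>.\<close>

lemma integral_idempotent_split:
  fixes P :: "'n::finite smat"
  assumes P: "intmat P" "P ** P = P" "congmat 2 P (blocks (mat 1) 0 0 0)"
  obtains V S :: "real^'n^('n + 'n)" where "intmat V" "intmat S" "congmat 2 V (stack (mat 1) 0)"
    "P ** V = V" "V ** transpose S = P" "transpose S ** V = mat 1"
proof -
  define L where "L = {V :: real^'n^('n + 'n). intmat V \<and> P ** V = V \<and> congmat 2 V (stack (mat 1) 0)}"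
  define top where "top = (\<lambda>V :: real^'n^('n + 'n). \<chi> i. V $ Inl i)"
  have top: "intmat (top V)" "congmat 2 (top V) (mat 1)" if "V \<in> L" for V
  proof -
    show "intmat (top V)" using that by (simp add: L_def top_def intmat_def)
    have "congmat 2 V (stack (mat 1) 0)" using that by (simp add: L_def)
    then have "\<exists>k::int. V $ Inl i $ j - stack (mat 1) 0 $ Inl i $ j = of_int (2 * k)" for i j
      unfolding congmat_def by blast
    then show "congmat 2 (top V) (mat 1)" by (simp add: congmat_def top_def)
  qed
  have st: "intmat (stack (mat 1 :: real^'n^'n) 0)"
    by (auto simp: intmat_def all_sum_iff mat_def)
  \<comment> \<open>The first n columns of \<open>P\<close> are a starting element of
    \<open>L\<close>.\<close>
  have "congmat 2 (P ** stack (mat 1) 0) (blocks (mat 1) 0 0 0 ** stack (mat 1) 0)"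
    using P(3) st by (rule congmat_mult_right)
  then have "P ** stack (mat 1) 0 \<in> L"
    using P st by (simp add: L_def intmat_mult matrix_mul_assoc blocks_mult_stack)
  \<comment> \<open>The determinants of top blocks over \<open>L\<close> are odd integers, so the
    floor of the absolute value is exact and a least positive value is attained.\<close>
  then obtain V where V: "V \<in> L"
    and min: "\<And>V'. V' \<in> L \<Longrightarrow> nat \<lfloor>\<bar>det (top V)\<bar>\<rfloor> \<le> nat \<lfloor>\<bar>det (top V')\<bar>\<rfloor>"
    using ex_has_least_nat[of "\<lambda>V. V \<in> L" _ "\<lambda>V. nat \<lfloor>\<bar>det (top V)\<bar>\<rfloor>"] by blast
  have VL: "intmat V" "P ** V = V" "congmat 2 V (stack (mat 1) 0)" using V by (auto simp: L_def)
  define A where "A = top V"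
  obtain C where VAC: "V = stack A C"
  proof -
    obtain A' C where "V = stack A' C" by (rule stack_exhaust)
    moreover from this have "A' = A" by (simp add: A_def top_def vec_eq_iff)
    ultimately show ?thesis using that by blast
  qed
  obtain p q r s where Pb: "P = blocks p q r s" by (metis blocks_blk)
  have invA: "invertible A" using invertible_cong_1_mod_2 top[OF V] by (simp add: A_def)
  note AA = matrix_inv_right[OF invA] matrix_inv_left[OF invA]
  \<comment> \<open>The columns of \<open>U1\<close> and \<open>U2\<close> are the coordinates of
    the columns of \<open>P\<close> with respect to \<open>V\<close>, computed over the reals from
    the top blocks alone.\<close>
  define U1 where "U1 = matrix_inv A ** p"
  define U2 where "U2 = matrix_inv A ** q"
  define S where "S = stack (transpose U1) (transpose U2)"
  have VS: "V ** transpose S = blocks p q (C ** U1) (C ** U2)"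
    by (simp add: VAC S_def stack_mult_transpose_stack U1_def U2_def matrix_mul_assoc AA)
  have SV: "transpose S ** V = mat 1"
  proof -
    have "transpose S ** V = matrix_inv A ** (p ** A + q ** C)"
      by (simp add: VAC S_def transpose_stack_mult_stack U1_def U2_def matrix_mul_assoc matrix_distribs)
    also have "p ** A + q ** C = A" using VL(2) by (simp add: VAC Pb blocks_mult_stack)
    finally show ?thesis by (simp add: AA)
  qed
  \<comment> \<open>The difference \<open>X\<close> of the two sides has zero top rows and is fixed
    by \<open>P\<close>, so \<open>s\<close> fixes its lower blocks. As \<open>s\<close> is even, 1
    - s is invertible, and these blocks vanish.\<close>
  have P_eq: "V ** transpose S = P"
  proof -
    have "intmat (mat 1 - s)" using P(1) by (simp add: Pb intmat_blocks intmat_diff)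
    moreover have "congmat 2 (mat 1 - s) (mat 1)"
    proof -
      have "congmat 2 s 0" using P(3) by (simp add: Pb congmat_blocks)
      then show ?thesis unfolding congmat_def by (simp, metis minus_minus mult_minus_right of_int_minus)
    qed
    ultimately have inv: "invertible (mat 1 - s)" by (rule invertible_cong_1_mod_2)
    have inj: "R = 0" if "s ** R = R" for R
    proof -
      have "(mat 1 - s) ** R = 0" using that by (simp add: matrix_distribs)
      then have "matrix_inv (mat 1 - s) ** (mat 1 - s) ** R = 0" by (simp flip: matrix_mul_assoc)
      then show ?thesis by (simp add: matrix_inv_left[OF inv])
    qed
    define X where "X = P - V ** transpose S"
    have X: "X = blocks 0 0 (r - C ** U1) (s - C ** U2)"
      by (simp add: X_def VS) (simp add: Pb vec_eq_iff all_sum_iff)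
    have "P ** X = X" by (simp add: X_def matrix_distribs P(2) matrix_mul_assoc VL(2))
    then have "r - C ** U1 = 0" "s - C ** U2 = 0"
      unfolding X Pb by (intro inj; simp add: blocks_mult)+
    then show ?thesis by (simp add: VS Pb)
  qed
  have "transpose S $ j $ k \<in> \<int>" for j k
  proof (rule ccontr)
    define c where "c = (\<chi> l. transpose S $ l $ k)"
    assume "transpose S $ j $ k \<notin> \<int>"
    then have cj: "c $ j \<notin> \<int>" by (simp add: c_def)
    \<comment> \<open>In the new column v + 2 (x - \<lceil>c\<rceil> v), with x the k-th column of
      \<open>P\<close>, this is the coefficient of v. The change is twice an integral vector, which
      keeps the congruence modulo 2.\<close>
    define z where "z = 1 - 2 * real_of_int \<lceil>c $ j\<rceil>"
    define V' where "V' = (\<chi> i l. if l = j then z * V $ i $ j + 2 * P $ i $ k else V $ i $ l)"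
    \<comment> \<open>The quantity is 1 - 2t with t = \<lceil>c\<rceil> - c, and non-integrality of
      c puts t strictly between 0 and 1.\<close>
    have zc: "\<bar>z + 2 * c $ j\<bar> < 1"
    proof -
      have "c $ j \<noteq> of_int \<lceil>c $ j\<rceil>" using cj by (metis Ints_of_int)
      then have "c $ j < of_int \<lceil>c $ j\<rceil>" using le_of_int_ceiling[of "c $ j"] by linarith
      moreover have "of_int \<lceil>c $ j\<rceil> < c $ j + 1" by linarith
      ultimately show ?thesis by (simp add: z_def abs_less_iff)
    qed
    have zint: "z \<in> \<int>" by (simp add: z_def)
    have "intmat V'"
      using VL(1) P(1) zint by (simp add: intmat_def V'_def)
    moreover have "P ** V' = V'"
    proof -
      have "(P ** V') $ i $ l = (if l = j then z * (P ** V) $ i $ j + 2 * (P ** P) $ i $ k else (P ** V) $ i $ l)" for i l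
        by (simp add: V'_def matrix_matrix_mult_def sum.distrib sum_distrib_left algebra_simps)
      then show ?thesis by (simp add: vec_eq_iff VL(2) P(2)) (simp add: V'_def)
    qed
    moreover have "congmat 2 V' V"
    proof -
      define K where "K = (\<chi> i l. if l = j then P $ i $ k - of_int \<lceil>c $ j\<rceil> * V $ i $ j else 0)"
      have "intmat K" using VL(1) P(1) by (simp add: intmat_def K_def)
      moreover have "V' - V = of_int 2 *\<^sub>R K"
        by (simp add: vec_eq_iff K_def V'_def z_def algebra_simps)
      ultimately show ?thesis unfolding congmat_iff by blast
    qed
    ultimately have V': "V' \<in> L" using VL(3) congmat_trans by (auto simp: L_def)
    \<comment> \<open>As \<open>A *v c\<close> is the top half of x, the new column of the top block
      is \<open>A\<close> applied to \<open>z *\<^sub>R axis j 1 + 2 *\<^sub>R c\<close>; by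
      Cramer's rule the determinant is scaled by the j-th coordinate of that vector.\<close>
    have "top V' = (\<chi> i l. if l = j then (A *v (z *\<^sub>R axis j 1 + 2 *\<^sub>R c)) $ i else A $ i $ l)"
    proof -
      have "(A *v c) $ i = P $ Inl i $ k" for i
      proof -
        have "(A *v c) $ i = (V ** transpose S) $ Inl i $ k"
          by (simp add: matrix_vector_mult_def matrix_matrix_mult_def c_def VAC)
        then show ?thesis by (simp add: P_eq)
      qed
      then have "(A *v (z *\<^sub>R axis j 1 + 2 *\<^sub>R c)) $ i = z * V $ Inl i $ j + 2 * P $ Inl i $ k" for i
        by (simp add: matrix_vector_right_distrib matrix_vector_mult_scaleR matrix_vector_mult_basis column_def A_def top_def)
      then show ?thesis by (simp add: vec_eq_iff top_def V'_def A_def)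
    qed
    then have "det (top V') = (z + 2 * c $ j) * det A"
      by (simp only: cramer_lemma) (simp add: axis_def)
    then have abs: "\<bar>det (top V')\<bar> = \<bar>z + 2 * c $ j\<bar> * \<bar>det A\<bar>" by (simp add: abs_mult)
    obtain d where d: "det A = of_int d" "odd d" using det_cong_1_mod_2[OF top[OF V]] unfolding A_def .
    obtain d' where d': "det (top V') = of_int d'" "odd d'" using det_cong_1_mod_2[OF top[OF V']] .
    have "\<bar>det A\<bar> > 0" using d by auto
    then have "\<bar>det (top V')\<bar> < \<bar>det A\<bar>" using zc abs by simp
    then have "\<bar>d'\<bar> < \<bar>d\<bar>" using d d' by (simp flip: of_int_abs)
    moreover have "nat \<bar>d\<bar> \<le> nat \<bar>d'\<bar>" using min[OF V'] d d' by (simp add: A_def flip: of_int_abs)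
    ultimately show False by linarith
  qed
  then have "intmat S" by (simp add: intmat_def transpose_def)
  then show ?thesis using that VL SV P_eq by blast
qed

lemma stack_Jmat_stack_real:
  "transpose (stack P Q) ** (Jmat ** stack P' Q') = transpose P ** Q' - transpose Q ** P'"
  by (simp add: Jmat_def blocks_mult_stack transpose_stack_mult_stack)

text \<open>Bases of the two eigenlattices of \<open>\<gamma> ** Tmat\<close> combine to an integral
  symplectic \<open>h\<close> conjugating \<open>Tmat\<close> to it. This provides both the
  exhaustion of the real points and the surjectivity onto cohomology.\<close>

lemma cocycle_trivial:
  fixes \<gamma> :: "'n::finite smat"
  assumes \<gamma>: "\<gamma> \<in> Gam (4 * m)" and coc: "\<gamma> ** tauM \<gamma> = mat 1"
  obtains g where "g \<in> Gam2m2 m" "\<gamma> = tauM g ** matrix_inv g"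
proof -
  have Sp: "\<gamma> \<in> Sp" using \<gamma> by (simp add: Gam_def SpZ_Sp)
  obtain K where K: "intmat K" "\<gamma> - mat 1 = of_int (4 * m) *\<^sub>R K"
    using \<gamma> unfolding Gam_def congmat_iff by blast
  define \<sigma> where "\<sigma> = \<gamma> ** Tmat"
  have \<sigma>\<sigma>: "\<sigma> ** \<sigma> = mat 1"
    using coc by (simp add: \<sigma>_def tauM_eq_conj matrix_mul_assoc)
  \<comment> \<open>The projection onto the eigenspace of \<sigma> for the eigenvalue 1.\<close>
  define P where "P = (1/2) *\<^sub>R (mat 1 + \<sigma>)"
  have \<sigma>P: "\<sigma> = 2 *\<^sub>R P - mat 1" by (simp add: P_def)
  have PP: "P ** P = P"
  proof -
    have "(mat 1 + \<sigma>) ** (mat 1 + \<sigma>) = 2 *\<^sub>R (mat 1 + \<sigma>)"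
      by (simp add: matrix_distribs \<sigma>\<sigma> scaleR_2)
    then show ?thesis
      by (simp add: P_def matrix_scalar_ac flip: scalar_matrix_assoc)
  qed
  \<comment> \<open>Halving \<sigma> \<equiv> T modulo 4m leaves a congruence for \<open>P\<close>
    modulo 2m, in particular modulo 2.\<close>
  have "P - blocks (mat 1) 0 0 0 = of_int 2 *\<^sub>R (of_int m *\<^sub>R (K ** Tmat))"
  proof -
    have "\<gamma> = mat 1 + of_int (4 * m) *\<^sub>R K" using K(2) by (simp add: algebra_simps)
    then have "\<sigma> = Tmat + of_int (4 * m) *\<^sub>R (K ** Tmat)"
      by (simp add: \<sigma>_def matrix_distribs scalar_matrix_assoc)
    moreover have "(1/2) *\<^sub>R (mat 1 + Tmat) = blocks (mat 1) 0 0 (0 :: real^'n^'n)"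
      by (simp add: Tmat_def mat_1_eq_blocks vec_eq_iff all_sum_iff)
    ultimately show ?thesis by (simp add: P_def algebra_simps)
  qed
  moreover have "intmat (of_int m *\<^sub>R (K ** Tmat))"
    using intmat_mult[OF K(1) intmat_Tmat] by (simp add: intmat_def)
  ultimately have Pcong: "congmat 2 P (blocks (mat 1) 0 0 0)" unfolding congmat_iff by blast
  have intP: "intmat P"
  proof -
    from Pcong obtain k where k: "intmat k" "P - blocks (mat 1) 0 0 0 = of_int 2 *\<^sub>R k" unfolding congmat_iff by blast
    then have "P = blocks (mat 1) 0 0 0 + (k + k)" by (simp add: scaleR_2 algebra_simps)
    moreover have "intmat (blocks (mat 1) 0 0 (0::real^'n^'n))" by (simp add: intmat_blocks)
    ultimately show ?thesis using k(1) by (metis intmat_add)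
  qed
  have "transpose \<sigma> ** Jmat ** \<sigma> = - Jmat"
  proof -
    have "transpose \<sigma> ** Jmat ** \<sigma> = Tmat ** (transpose \<gamma> ** Jmat ** \<gamma>) ** Tmat"
      by (simp add: \<sigma>_def matrix_transpose_mul matrix_mul_assoc)
    also have "\<dots> = Tmat ** Jmat ** Tmat" using Sp by (simp add: Sp_def)
    finally show ?thesis by (simp add: Tmat_Jmat flip: matrix_mul_assoc)
  qed
  then have "transpose \<sigma> ** Jmat ** (\<sigma> ** \<sigma>) = - Jmat ** \<sigma>" by (simp add: matrix_mul_assoc)
  then have \<sigma>J: "transpose \<sigma> ** Jmat = - (Jmat ** \<sigma>)" by (simp add: \<sigma>\<sigma>)
  \<comment> \<open>The projections \<open>P\<close> and 1 - P are adjoint for the symplectic form,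
    which makes the image and the kernel of \<open>P\<close> isotropic.\<close>
  have PJ: "transpose P ** Jmat = Jmat ** (mat 1 - P)"
  proof -
    have "mat 1 - P = (1/2) *\<^sub>R (mat 1 - \<sigma>)" by (simp add: P_def vec_eq_iff field_simps)
    then have "Jmat ** (mat 1 - P) = (1/2) *\<^sub>R (Jmat - Jmat ** \<sigma>)"
      by (simp add: matrix_distribs matrix_scalar_ac scaleR_diff_right flip: scalar_matrix_assoc)
    then show ?thesis
      by (simp add: P_def transpose_scalar transpose_add matrix_distribs \<sigma>J flip: scalar_matrix_assoc)
  qed
  have JP: "P ** Jmat = Jmat ** (mat 1 - transpose P)"
  proof -
    have "Jmat ** (transpose P ** Jmat) ** Jmat = Jmat ** (Jmat ** (mat 1 - P)) ** Jmat"
      by (simp only: PJ)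
    then show ?thesis
      by (simp add: matrix_distribs flip: matrix_mul_assoc)
        (simp add: matrix_distribs matrix_mul_assoc eq_diff_eq diff_eq_eq)
  qed
  obtain V S :: "real^'n^('n + 'n)" where VS: "intmat V" "intmat S" "congmat 2 V (stack (mat 1) 0)"
    "P ** V = V" "V ** transpose S = P" "transpose S ** V = mat 1"
    using integral_idempotent_split[OF intP PP Pcong] .
  \<comment> \<open>Chosen so that \<open>Jmat ** W = S\<close>: the columns of \<open>W\<close> lie
    in the kernel of \<open>P\<close> and are dual to those of \<open>V\<close> under the symplectic
    form.\<close>
  define W where "W = - (Jmat ** S)"
  have PS: "transpose P ** S = S"
  proof -
    have "transpose P = S ** transpose V" by (simp flip: VS(5) add: matrix_transpose_mul)
    then have "transpose P ** S = S ** transpose (transpose S ** V)"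
      by (simp add: matrix_transpose_mul matrix_mul_assoc)
    then show ?thesis by (simp add: VS(6))
  qed
  have JW: "Jmat ** W = S" by (simp add: W_def matrix_mul_assoc)
  have PW: "P ** W = 0"
    by (simp add: W_def matrix_mul_assoc JP) (simp add: PS matrix_distribs flip: matrix_mul_assoc)
  have VJV: "transpose V ** (Jmat ** V) = 0"
  proof -
    have "transpose V ** (Jmat ** V) = transpose (P ** V) ** (Jmat ** V)" by (simp add: VS(4))
    also have "\<dots> = transpose V ** (transpose P ** Jmat) ** V"
      by (simp add: matrix_transpose_mul matrix_mul_assoc)
    finally show ?thesis by (simp add: PJ VS(4) matrix_distribs flip: matrix_mul_assoc)
  qed
  have VJW: "transpose V ** (Jmat ** W) = mat 1"
    using arg_cong[OF VS(6), of transpose] by (simp add: JW matrix_transpose_mul)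
  have WJV: "transpose W ** (Jmat ** V) = - mat 1"
    using VS(6) by (simp add: W_def matrix_transpose_mul matrix_mul_assoc) (simp flip: matrix_mul_assoc)
  have WJW: "transpose W ** (Jmat ** W) = 0"
  proof -
    have "transpose W ** (Jmat ** W) = transpose W ** (transpose P ** S)" by (simp add: JW PS)
    also have "\<dots> = transpose (P ** W) ** S" by (simp add: matrix_transpose_mul matrix_mul_assoc)
    finally show ?thesis by (simp add: PW)
  qed
  obtain A C where VAC: "V = stack A C" by (rule stack_exhaust)
  obtain B D where WBD: "W = stack B D" by (rule stack_exhaust)
  define h where "h = blocks A B C D"
  have AD: "transpose A ** D - transpose C ** B = mat 1"
    using VJW by (simp add: VAC WBD stack_Jmat_stack_real)
  have hSp: "h \<in> Sp"
    using VJV VJW WJV WJW unfolding VAC WBD stack_Jmat_stack_real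
    by (simp add: Sp_def h_def Jmat_def transpose_blocks blocks_mult)
  have "intmat W" by (simp add: W_def intmat_uminus intmat_mult VS(2))
  then have "intmat h" using VS(1) by (simp add: h_def VAC WBD intmat_def all_sum_iff)
  then have hZ: "h \<in> SpZ" using hSp by (simp add: SpZ_def)
  \<comment> \<open>The columns of \<open>V\<close> and \<open>W\<close> are eigenvectors of
    \<sigma> for the eigenvalues 1 and -1.\<close>
  have "\<sigma> ** h = h ** Tmat"
  proof -
    have "P ** h = blocks A 0 C 0"
    proof -
      obtain p q r s where Pb: "P = blocks p q r s" by (metis blocks_blk)
      have "stack (0 :: real^'n^'n) 0 = 0" by (simp add: vec_eq_iff all_sum_iff)
      then have "P ** stack B D = stack 0 0" using PW by (simp add: WBD)
      then show ?thesis using VS(4)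
        by (simp add: VAC Pb h_def blocks_mult blocks_mult_stack)
    qed
    then have "\<sigma> ** h = 2 *\<^sub>R blocks A 0 C 0 - h"
      by (simp add: \<sigma>P matrix_distribs flip: scalar_matrix_assoc)
    also have "\<dots> = h ** Tmat"
      by (simp add: h_def Tmat_def blocks_mult) (simp add: vec_eq_iff all_sum_iff)
    finally show ?thesis .
  qed
  then have \<gamma>h: "\<gamma> ** tauM h = h"
    by (simp add: \<sigma>_def tauM_eq_conj matrix_mul_assoc) (simp flip: matrix_mul_assoc)
  have "congmat 2 A (mat 1)" "congmat 2 C 0"
    using VS(3) by (simp_all add: VAC congmat_def all_sum_iff)
  \<comment> \<open>The relation \<open>AD\<close>, read modulo 2 with A \<equiv> 1 and C \<equiv>
    0, leaves D \<equiv> 1.\<close>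
  have "congmat 2 D (mat 1)"
  proof -
    have ih: "intmat A" "intmat B" "intmat C" "intmat D" using \<open>intmat h\<close> by (simp_all add: h_def intmat_blocks)
    have "congmat 2 (transpose A ** D) (mat 1 ** D)" "congmat 2 (transpose C ** B) (0 ** B)"
      using congmat_mult_right[OF congmat_transpose[OF \<open>congmat 2 A (mat 1)\<close>] ih(4)]
        congmat_mult_right[OF congmat_transpose[OF \<open>congmat 2 C 0\<close>] ih(2)] by simp_all
    then obtain k l where k: "intmat k" "transpose A ** D - D = of_int 2 *\<^sub>R k" "intmat l" "transpose C ** B = of_int 2 *\<^sub>R l"
      unfolding congmat_iff by auto
    have "D - mat 1 = of_int 2 *\<^sub>R (l - k)"
      using k(2,4) AD by (simp add: scaleR_diff_right algebra_simps)
    then show ?thesis using intmat_diff[OF k(3,1)] unfolding congmat_iff by blast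
  qed
  \<comment> \<open>Since \<gamma> is congruent to 1 modulo 4m, the identity \<gamma> \<tau>(h) = h
    yields the condition on the off-diagonal blocks of \<open>h\<close>.\<close>
  moreover have "congmat (4*m) (tauM h) h"
  proof -
    have "congmat (4*m) (\<gamma> ** tauM h) (mat 1 ** tauM h)"
      using \<gamma> hZ by (intro congmat_mult_right) (auto simp: Gam_def SpZ_tauM SpZ_int)
    then show ?thesis by (simp add: \<gamma>h congmat_sym)
  qed
  ultimately have "h \<in> Gam2m2 m"
    using hZ \<open>congmat 2 A (mat 1)\<close> by (simp add: Gam2m2_iff_blk h_def)
  then have "tauM h \<in> Gam2m2 m" by (rule Gam2m2_tauM)
  moreover have "\<gamma> = tauM (tauM h) ** matrix_inv (tauM h)"
  proof -
    have "\<gamma> ** (tauM h ** matrix_inv (tauM h)) = h ** matrix_inv (tauM h)"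
      by (simp add: \<gamma>h matrix_mul_assoc)
    then show ?thesis by (simp add: Sp_inv_right Sp_tauM hSp)
  qed
  ultimately show ?thesis by (rule that)
qed

subsection \<open>Real points\<close>

lemma act_inv_act:
  assumes "g \<in> Sp" "Z \<in> siegel"
  shows "act (matrix_inv g) (act g Z) = Z" "act g (act (matrix_inv g) Z) = Z"
  using assms act_mult[of "matrix_inv g" g Z] act_mult[of g "matrix_inv g" Z]
  by (simp_all add: Sp_matrix_inv Sp_inv_left Sp_inv_right)

lemma Gam_Sp: "g \<in> Gam N \<Longrightarrow> g \<in> Sp"
  by (simp add: Gam_def SpZ_Sp)

lemma Gam2m2_Sp: "g \<in> Gam2m2 m \<Longrightarrow> g \<in> Sp"
  by (simp add: Gam2m2_SpZ SpZ_Sp)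

lemma orb_eq_iff:
  assumes "Z \<in> siegel" "W \<in> siegel"
  shows "orb (Gam N) Z = orb (Gam N) W \<longleftrightarrow> (\<exists>\<gamma>\<in>Gam N. W = act \<gamma> Z)"
proof
  assume "orb (Gam N) Z = orb (Gam N) W"
  moreover have "W \<in> orb (Gam N) W" unfolding orb_def by (rule image_eqI[of _ _ "mat 1"]) simp_all
  ultimately show "\<exists>\<gamma>\<in>Gam N. W = act \<gamma> Z" by (auto simp: orb_def)
next
  have sub: "orb (Gam N) (act \<gamma> X) \<subseteq> orb (Gam N) X" if "\<gamma> \<in> Gam N" "X \<in> siegel" for \<gamma> X
  proof
    fix Y assume "Y \<in> orb (Gam N) (act \<gamma> X)"
    then obtain \<delta> where \<delta>: "\<delta> \<in> Gam N" "Y = act \<delta> (act \<gamma> X)" by (auto simp: orb_def)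
    then have "Y = act (\<delta> ** \<gamma>) X" using that by (simp add: act_mult Gam_Sp)
    then show "Y \<in> orb (Gam N) X" using that \<delta> Gam_mult by (auto simp: orb_def)
  qed
  assume "\<exists>\<gamma>\<in>Gam N. W = act \<gamma> Z"
  then obtain \<gamma> where \<gamma>: "\<gamma> \<in> Gam N" "W = act \<gamma> Z" by blast
  then have "Z = act (matrix_inv \<gamma>) W" using assms by (simp add: act_inv_act Gam_Sp)
  then show "orb (Gam N) Z = orb (Gam N) W"
    using sub[OF \<gamma>(1) assms(1)] sub[OF Gam_inv[OF \<gamma>(1)] assms(2)] \<gamma>(2) by auto
qed

text \<open>The equation Z = \<tau>(Z) says that the real part of \<open>Z\<close> vanishes.\<close>

lemma iCn_iff: "Z \<in> iCn \<longleftrightarrow> Z \<in> siegel \<and> tauZ Z = Z"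
proof
  assume "Z \<in> iCn"
  then obtain Y where Y: "posdef Y" "Z = (\<chi> i j. \<i> * complex_of_real (Y $ i $ j))" by (auto simp: iCn_def Cn_def)
  have "ImM Z = Y" by (simp add: Y(2) ImM_def vec_eq_iff)
  moreover have "Y $ i $ j = Y $ j $ i" for i j
  proof -
    have "transpose Y $ i $ j = Y $ i $ j" using Y(1) by (simp add: posdef_def)
    then show ?thesis by (simp add: transpose_def)
  qed
  ultimately show "Z \<in> siegel \<and> tauZ Z = Z"
    using Y(1) by (simp add: siegel_def) (simp add: Y(2) transpose_def vec_eq_iff tauZ_def)
next
  assume Z: "Z \<in> siegel \<and> tauZ Z = Z"
  have "Z $ i $ j = \<i> * complex_of_real (ImM Z $ i $ j)" for i j
  proof -
    have "tauZ Z $ i $ j = Z $ i $ j" using Z by simp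
    then have "- cnj (Z $ i $ j) = Z $ i $ j" by (simp add: tauZ_def)
    then show ?thesis by (simp add: ImM_def complex_eq_iff)
  qed
  then have "Z = (\<chi> i j. \<i> * complex_of_real (ImM Z $ i $ j))" by (simp add: vec_eq_iff)
  then show "Z \<in> iCn" using Z unfolding iCn_def Cn_def siegel_def by blast
qed

lemma iCn_siegel: "Z \<in> iCn \<Longrightarrow> Z \<in> siegel" and iCn_tauZ: "Z \<in> iCn \<Longrightarrow> tauZ Z = Z"
  by (simp_all add: iCn_iff)

text \<open>With Z = gX the defining equation becomes \<tau>(g) X = \<tau>(g) \<tau>(X), that is, X
  = \<tau>(X).\<close>

lemma fixset_eq:
  assumes "g \<in> Sp" shows "fixset (tauM g ** matrix_inv g) = act g ` iCn"
proof -
  have *: "act (tauM g ** matrix_inv g) Z = tauZ Z \<longleftrightarrow> act (matrix_inv g) Z \<in> iCn" if Z: "Z \<in> siegel" for Z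
  proof -
    define X where "X = act (matrix_inv g) Z"
    have X: "X \<in> siegel" "Z = act g X"
      using assms Z by (simp_all add: X_def act_siegel Sp_matrix_inv act_inv_act)
    have "act (tauM g ** matrix_inv g) Z = act (tauM g) X"
      using assms Z by (simp add: act_mult Sp_tauM Sp_matrix_inv X_def)
    moreover have "tauZ Z = act (tauM g) (tauZ X)" using assms X by (simp add: tauZ_act)
    ultimately have "act (tauM g ** matrix_inv g) Z = tauZ Z \<longleftrightarrow> tauZ X = X"
      using act_inv_act(1)[OF Sp_tauM[OF assms]] X(1) tauZ_siegel by metis
    then show ?thesis using X(1) by (simp add: iCn_iff flip: X_def)
  qed
  show ?thesis
  proof (intro set_eqI iffI)
    fix Z assume "Z \<in> fixset (tauM g ** matrix_inv g)"
    then have "Z \<in> siegel" "act (matrix_inv g) Z \<in> iCn" using * by (auto simp: fixset_def)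
    then show "Z \<in> act g ` iCn" using assms by (intro image_eqI[of _ _ "act (matrix_inv g) Z"]) (simp_all add: act_inv_act)
  next
    fix Z assume "Z \<in> act g ` iCn"
    then obtain X where X: "X \<in> iCn" "Z = act g X" by blast
    then have "Z \<in> siegel" "act (matrix_inv g) Z = X" using assms by (simp_all add: iCn_siegel act_siegel act_inv_act)
    then show "Z \<in> fixset (tauM g ** matrix_inv g)" using * X by (simp add: fixset_def)
  qed
qed

text \<open>Applying \<tau> to the \<tau>-fixed point \<open>act h Z\<close> shows that
  \<open>h\<close> and \<tau>(h) agree at \<open>Z\<close>; their quotient lies in
  \<open>Gam (4*m)\<close>, where stabilizers are trivial.\<close>

lemma Gam2m2_iCn_tauM:
  assumes "h \<in> Gam2m2 m" "Z \<in> iCn" "act h Z \<in> iCn"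
  shows "tauM h = h"
proof -
  note Sp = Gam2m2_Sp[OF assms(1)] and Z = iCn_siegel[OF assms(2)]
  have "act (tauM h) Z = act h Z"
    using tauZ_act[OF Sp Z] assms(2,3) by (simp add: iCn_tauZ)
  then have "act (matrix_inv h ** tauM h) Z = Z"
    using Sp Z by (simp add: act_mult Sp_matrix_inv Sp_tauM act_inv_act)
  then have "matrix_inv h ** tauM h = mat 1"
    using Gam_stabilizer_trivial[OF Gam2m2_quot_Gam(2)[OF assms(1)] Z] by simp
  then have "h ** matrix_inv h ** tauM h = h" by (simp flip: matrix_mul_assoc)
  then show ?thesis by (simp add: Sp_inv_right Sp)
qed

text \<open>Such an \<open>h\<close> commutes with \<tau> on the Siegel space, and so does its
  inverse.\<close>

lemma act_tauM_fixed_iCn: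
  assumes "h \<in> Sp" "tauM h = h" shows "act h ` iCn = iCn"
proof -
  have sub: "act k ` iCn \<subseteq> iCn" if "k \<in> Sp" "tauM k = k" for k :: "'a smat"
    using that tauZ_act[OF that(1)] by (auto simp: iCn_iff act_siegel)
  have inv: "tauM (matrix_inv h) = matrix_inv h" using assms by (metis matrix_inv_tauM)
  have "iCn \<subseteq> act h ` iCn"
  proof
    fix Z :: "complex^'a^'a" assume Z: "Z \<in> iCn"
    then have "act (matrix_inv h) Z \<in> iCn" using sub[OF Sp_matrix_inv[OF assms(1)] inv] by blast
    moreover have "Z = act h (act (matrix_inv h) Z)" using Z assms(1) by (simp add: act_inv_act iCn_siegel)
    ultimately show "Z \<in> act h ` iCn" by blast
  qed
  then show ?thesis using sub[OF assms] by blast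
qed

section \<open>Double cosets and real points\<close>

lemma Gaml_SpZ: "h \<in> Gaml N \<Longrightarrow> h \<in> SpZ" and Gaml_tauM: "h \<in> Gaml N \<Longrightarrow> tauM h = h"
  by (simp_all add: Gaml_iff)

lemma Gaml_Sp: "h \<in> Gaml N \<Longrightarrow> h \<in> Sp"
  by (simp add: Gaml_SpZ SpZ_Sp)

lemma Gaml_iff_Gam: "h \<in> Gaml N \<longleftrightarrow> h \<in> Gam N \<and> tauM h = h"
  using Gaml_in_Gam Gam_SpZ Gaml_SpZ Gaml_tauM by metis

lemma Gaml_mult: "g \<in> Gaml N \<Longrightarrow> h \<in> Gaml N \<Longrightarrow> g ** h \<in> Gaml N"
  by (simp add: Gaml_iff_Gam Gam_mult tauM_mult)

lemma Gaml_inv: "h \<in> Gaml N \<Longrightarrow> matrix_inv h \<in> Gaml N"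
  using matrix_inv_tauM[of h] Gam_Sp[of h N] by (auto simp: Gaml_iff_Gam Gam_inv)

text \<open>For \<tau>-fixed \<open>h\<close> the congruence \<tau>(h) \<equiv> h in
  \<open>Gam2m2_iff\<close> is an equality, whatever \<open>m\<close> is.\<close>

lemma Gaml_2_iff: "h \<in> Gaml 2 \<longleftrightarrow> h \<in> Gam2m2 m \<and> tauM h = h"
  by (auto simp: Gaml_iff_Gam Gam2m2_iff Gam_def)

lemma dcoset_self: "g \<in> dcoset (Gam N) g (Gaml 2)"
  unfolding dcoset_def
  by (intro CollectI exI[of _ "mat 1"]) (auto simp: Gaml_iff_Gam)

lemma dcoset_eq:
  assumes "g' \<in> dcoset (Gam N) g (Gaml 2)"
  shows "dcoset (Gam N) g' (Gaml 2) = dcoset (Gam N) g (Gaml 2)"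
proof -
  have sub: "dcoset (Gam N) x (Gaml 2) \<subseteq> dcoset (Gam N) y (Gaml 2)"
    if xy: "x = a ** y ** b" "a \<in> Gam N" "b \<in> Gaml 2" for x y a b :: "'a smat"
  proof
    fix z assume "z \<in> dcoset (Gam N) x (Gaml 2)"
    then obtain c d where cd: "c \<in> Gam N" "d \<in> Gaml 2" "z = c ** x ** d" by (auto simp: dcoset_def)
    then have "z = (c ** a) ** y ** (b ** d)" by (simp add: xy(1) matrix_mul_assoc)
    then show "z \<in> dcoset (Gam N) y (Gaml 2)"
      using Gam_mult[OF cd(1) xy(2)] Gaml_mult[OF xy(3) cd(2)] unfolding dcoset_def by blast
  qed
  obtain a b where ab: "g' = a ** g ** b" "a \<in> Gam N" "b \<in> Gaml 2" using assms by (auto simp: dcoset_def)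
  have "matrix_inv a ** g' ** matrix_inv b = (matrix_inv a ** a) ** g ** (b ** matrix_inv b)"
    by (simp add: ab(1) matrix_mul_assoc)
  then have "g = matrix_inv a ** g' ** matrix_inv b"
    using ab by (simp add: Sp_inv_left Sp_inv_right Gam_Sp Gaml_Sp)
  then show ?thesis using sub[OF ab] sub[OF _ Gam_inv[OF ab(2)] Gaml_inv[OF ab(3)]] by blast
qed

text \<open>The element h = g'^-1 a g is \<tau>-fixed and lies in \<open>Gam2m2 m\<close>, hence in
  \<open>Gaml 2\<close>; solving for g' gives a g h^-1.\<close>

lemma dcosetI_tauM:
  assumes g: "g \<in> Gam2m2 m" "g' \<in> Gam2m2 m" and a: "a \<in> Gam (4*m)"
    and \<tau>: "tauM (matrix_inv g' ** a ** g) = matrix_inv g' ** a ** g"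
  shows "g' \<in> dcoset (Gam (4*m)) g (Gaml 2)"
proof -
  let ?h = "matrix_inv g' ** a ** g"
  have "?h \<in> Gam2m2 m" using g Gam_subset_Gam2m2[OF a] by (intro Gam2m2_mult Gam2m2_inv)
  then have h: "?h \<in> Gaml 2" using \<tau> Gaml_2_iff by blast
  have "a ** g = g' ** ?h"
    using g by (simp add: matrix_mul_assoc Sp_inv_right Gam2m2_Sp)
  then have "a ** g ** matrix_inv ?h = g' ** (?h ** matrix_inv ?h)"
    by (simp only: matrix_mul_assoc)
  then have "g' = a ** g ** matrix_inv ?h"
    using Sp_inv_right[OF Gaml_Sp[OF h]] by simp
  then show ?thesis using a Gaml_inv[OF h] unfolding dcoset_def by blast
qed

text \<open>The element g'^-1 \<gamma> g carries X to X', so \<open>Gam2m2_iCn_tauM\<close> applies.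
  The case g = g' serves injectivity, the general case disjointness.\<close>

lemma orb_iCn_eq_D:
  assumes g: "g \<in> Gam2m2 m" "g' \<in> Gam2m2 m" and X: "X \<in> iCn" "X' \<in> iCn" and \<gamma>: "\<gamma> \<in> Gam (4*m)"
    and eq: "act g' X' = act \<gamma> (act g X)"
  shows "tauM (matrix_inv g' ** \<gamma> ** g) = matrix_inv g' ** \<gamma> ** g"
    and "act (matrix_inv g' ** \<gamma> ** g) X = X'"
proof -
  let ?h = "matrix_inv g' ** \<gamma> ** g"
  have "act ?h X = act (matrix_inv g') (act g' X')"
    using g \<gamma> X by (simp add: eq act_mult act_siegel Sp_mult Sp_matrix_inv Gam2m2_Sp Gam_Sp iCn_siegel)
  then show h: "act ?h X = X'" using g X by (simp add: act_inv_act Gam2m2_Sp iCn_siegel)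
  have "?h \<in> Gam2m2 m" using g Gam_subset_Gam2m2[OF \<gamma>] by (intro Gam2m2_mult Gam2m2_inv)
  then show "tauM ?h = ?h" using X h by (intro Gam2m2_iCn_tauM[of _ m X]) auto
qed

lemma XR_eq: "XR (Gam N) = orb (Gam N) ` (\<Union>\<gamma>\<in>Gam N. fixset \<gamma>)"
proof -
  have "orb (Gam N) (tauZ Z) = orb (Gam N) Z \<longleftrightarrow> (\<exists>\<gamma>\<in>Gam N. Z \<in> fixset \<gamma>)" if "Z \<in> siegel" for Z :: "complex^'a^'a"
    using orb_eq_iff[OF that tauZ_siegel[OF that], of N] that unfolding fixset_def by (simp add: eq_commute)
  then show ?thesis unfolding XR_def by (auto simp: fixset_def)
qed

text \<open>The product \<tau>(\<gamma>) \<gamma> fixes \<open>Z\<close> and is therefore trivial; a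
  one-sided inverse of a square matrix is two-sided, which gives the other order.\<close>

lemma fixset_Gam_cocycle:
  assumes "\<gamma> \<in> Gam (4*m)" "Z \<in> fixset \<gamma>" shows "\<gamma> ** tauM \<gamma> = mat 1"
proof -
  have Z: "Z \<in> siegel" "act \<gamma> Z = tauZ Z" using assms by (auto simp: fixset_def)
  have "act (tauM \<gamma> ** \<gamma>) Z = act (tauM \<gamma>) (tauZ Z)"
    using assms Z by (simp add: act_mult Gam_Sp Sp_tauM)
  also have "\<dots> = Z" using tauZ_act[OF Gam_Sp[OF assms(1)] Z(1)] Z by simp
  finally have "tauM \<gamma> ** \<gamma> = mat 1"
    using Gam_stabilizer_trivial[OF Gam_mult[OF Gam_tauM[OF assms(1)] assms(1)] Z(1)] by simp
  then show ?thesis by (simp add: matrix_left_right_inverse)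
qed

section \<open>Cohomology classes and double cosets\<close>

lemma cocycle_of_Gam2m2:
  assumes "g \<in> Gam2m2 m" shows "tauM g ** matrix_inv g \<in> cocycles (Gam (4*m))"
proof -
  have Sp: "g \<in> Sp" using assms by (rule Gam2m2_Sp)
  have "tauM g ** matrix_inv g ** tauM (tauM g ** matrix_inv g)
      = tauM g ** (matrix_inv g ** g) ** tauM (matrix_inv g)"
    by (simp add: tauM_mult matrix_mul_assoc)
  also have "\<dots> = tauM (g ** matrix_inv g)" using Sp by (simp add: Sp_inv_left tauM_mult)
  finally show ?thesis using Sp Gam2m2_quot_Gam(1)[OF assms] by (simp add: cocycles_def Sp_inv_right)
qed

lemma cohclass_eq_iff:
  assumes "\<gamma> \<in> cocycles (Gam N)" "\<gamma>' \<in> cocycles (Gam N)"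
  shows "cohclass (Gam N) \<gamma> = cohclass (Gam N) \<gamma>' \<longleftrightarrow> (\<exists>h\<in>Gam N. \<gamma>' = tauM h ** \<gamma> ** matrix_inv h)"
proof
  assume eq: "cohclass (Gam N) \<gamma> = cohclass (Gam N) \<gamma>'"
  have "\<gamma>' = tauM (mat 1) ** \<gamma>' ** matrix_inv (mat 1)"
    using matrix_inv_eqI[of "mat 1" "mat 1 :: 'a smat"] by simp
  then have "\<gamma>' \<in> cohclass (Gam N) \<gamma>'" using assms Gam_1 unfolding cohclass_def by blast
  then show "\<exists>h\<in>Gam N. \<gamma>' = tauM h ** \<gamma> ** matrix_inv h" unfolding eq[symmetric] by (auto simp: cohclass_def)
next
  have sub: "cohclass (Gam N) y \<subseteq> cohclass (Gam N) x"
    if y: "y = tauM h ** x ** matrix_inv h" "h \<in> Gam N" for x y h :: "'a smat"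
  proof
    fix z assume "z \<in> cohclass (Gam N) y"
    then obtain k where k: "z \<in> cocycles (Gam N)" "k \<in> Gam N" "z = tauM k ** y ** matrix_inv k"
      by (auto simp: cohclass_def)
    then have "z = tauM (k ** h) ** x ** matrix_inv (k ** h)"
      using y(2) by (simp add: y(1) tauM_mult matrix_inv_mult_Sp Gam_Sp matrix_mul_assoc)
    then show "z \<in> cohclass (Gam N) x" using k Gam_mult[OF k(2) y(2)] unfolding cohclass_def by blast
  qed
  assume "\<exists>h\<in>Gam N. \<gamma>' = tauM h ** \<gamma> ** matrix_inv h"
  then obtain h where h: "h \<in> Gam N" "\<gamma>' = tauM h ** \<gamma> ** matrix_inv h" by blast
  have Sp: "h \<in> Sp" using h(1) by (rule Gam_Sp)
  have "tauM (matrix_inv h) ** \<gamma>' ** matrix_inv (matrix_inv h)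
     = tauM (matrix_inv h ** h) ** \<gamma> ** (matrix_inv h ** h)"
    using Sp by (simp add: h(2) tauM_mult matrix_inv_matrix_inv_Sp matrix_mul_assoc)
  then have "\<gamma> = tauM (matrix_inv h) ** \<gamma>' ** matrix_inv (matrix_inv h)"
    using Sp by (simp add: Sp_inv_left)
  then show "cohclass (Gam N) \<gamma> = cohclass (Gam N) \<gamma>'"
    using sub[OF h(2,1)] sub[OF _ Gam_inv[OF h(1)]] by blast
qed

text \<open>The same a in \<open>Gam (4*m)\<close> witnesses both relations: it makes the two
  cocycles cohomologous exactly when g'^-1 a g is \<tau>-fixed.\<close>

lemma cohclass_eq_iff_dcoset_eq:
  assumes g: "g \<in> Gam2m2 m" "g' \<in> Gam2m2 m"
  shows "cohclass (Gam (4*m)) (tauM g ** matrix_inv g) = cohclass (Gam (4*m)) (tauM g' ** matrix_inv g')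
    \<longleftrightarrow> dcoset (Gam (4*m)) g (Gaml 2) = dcoset (Gam (4*m)) g' (Gaml 2)"
proof -
  note Sp = Gam2m2_Sp[OF g(1)] Gam2m2_Sp[OF g(2)]
  have "(\<exists>h\<in>Gam (4*m). tauM g' ** matrix_inv g' = tauM h ** (tauM g ** matrix_inv g) ** matrix_inv h)
     \<longleftrightarrow> g' \<in> dcoset (Gam (4*m)) g (Gaml 2)"
  proof
    assume "\<exists>h\<in>Gam (4*m). tauM g' ** matrix_inv g' = tauM h ** (tauM g ** matrix_inv g) ** matrix_inv h"
    then obtain a where a: "a \<in> Gam (4*m)" "tauM g' ** matrix_inv g' = tauM a ** (tauM g ** matrix_inv g) ** matrix_inv a" by blast
    have Spa: "a \<in> Sp" using a(1) by (rule Gam_Sp)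
    have "tauM (matrix_inv g') ** (tauM g' ** matrix_inv g') ** (a ** g)
       = tauM (matrix_inv g') ** tauM a ** tauM g ** matrix_inv g ** (matrix_inv a ** a) ** g"
      unfolding a(2) by (simp only: matrix_mul_assoc)
    also have "\<dots> = tauM (matrix_inv g' ** a ** g) ** (matrix_inv g ** g)"
      by (simp add: Sp_inv_left Spa tauM_mult matrix_mul_assoc)
    finally have "tauM (matrix_inv g') ** tauM g' ** (matrix_inv g' ** a ** g) = tauM (matrix_inv g' ** a ** g)"
      using Sp_inv_left[OF Sp(1)] by (simp only: matrix_mul_assoc matrix_mul_rid)
    then have "tauM (matrix_inv g' ** a ** g) = matrix_inv g' ** a ** g"
      by (simp add: Sp_inv_left Sp flip: tauM_mult)
    then show "g' \<in> dcoset (Gam (4*m)) g (Gaml 2)" using g a(1) by (intro dcosetI_tauM)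
  next
    assume "g' \<in> dcoset (Gam (4*m)) g (Gaml 2)"
    then obtain a b where ab: "g' = a ** g ** b" "a \<in> Gam (4*m)" "b \<in> Gaml 2" by (auto simp: dcoset_def)
    have Spab: "a \<in> Sp" "b \<in> Sp" "a ** g \<in> Sp" using ab Sp by (auto simp: Gam_Sp Gaml_Sp Sp_mult)
    have "tauM g' ** matrix_inv g' = tauM a ** tauM g ** (b ** matrix_inv b) ** matrix_inv g ** matrix_inv a"
      using Spab Sp ab(3) by (simp add: ab(1) tauM_mult Gaml_tauM matrix_inv_mult_Sp matrix_mul_assoc)
    then have "tauM g' ** matrix_inv g' = tauM a ** (tauM g ** matrix_inv g) ** matrix_inv a"
      using Spab by (simp add: Sp_inv_right matrix_mul_assoc)
    then show "\<exists>h\<in>Gam (4*m). tauM g' ** matrix_inv g' = tauM h ** (tauM g ** matrix_inv g) ** matrix_inv h"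
      using ab(2) by blast
  qed
  also have "\<dots> \<longleftrightarrow> dcoset (Gam (4*m)) g (Gaml 2) = dcoset (Gam (4*m)) g' (Gaml 2)"
    using dcoset_eq dcoset_self by metis
  finally show ?thesis using cohclass_eq_iff[OF cocycle_of_Gam2m2[OF g(1)] cocycle_of_Gam2m2[OF g(2)]] by simp
qed

text \<open>Elements with equal residues modulo 4m differ by a left factor in
  \<open>Gam (4*m)\<close>, and there are finitely many residue patterns.\<close>

lemma finite_dcosets:
  assumes "m \<ge> 1"
  shows "finite ((\<lambda>g. dcoset (Gam (4*m)) g (Gaml 2)) ` (Gam2m2 m :: 'n::finite smat set))"
proof -
  define r where "r = (\<lambda>g :: 'n smat. \<lambda>(i, j). \<lfloor>g $ i $ j\<rfloor> mod (4*m))"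
  have "range r \<subseteq> (UNIV \<rightarrow>\<^sub>E {0..<4*m})" using assms by (auto simp: r_def)
  then have fin: "finite (r ` Gam2m2 m)"
    by (rule finite_subset[OF subset_trans[OF image_mono[OF subset_UNIV]]]) (simp add: finite_PiE)
  have eq: "dcoset (Gam (4*m)) g (Gaml 2) = dcoset (Gam (4*m)) g' (Gaml 2)"
    if g: "g \<in> Gam2m2 m" "g' \<in> Gam2m2 m" "r g = r g'" for g g' :: "'n smat"
  proof -
    have "congmat (4*m) g g'" unfolding congmat_def
    proof (intro allI)
      fix i j
      have "\<lfloor>g $ i $ j\<rfloor> mod (4*m) = \<lfloor>g' $ i $ j\<rfloor> mod (4*m)" using fun_cong[OF g(3), of "(i, j)"] by (simp add: r_def)
      then obtain k where k: "\<lfloor>g $ i $ j\<rfloor> - \<lfloor>g' $ i $ j\<rfloor> = 4*m*k" by (metis mod_eq_dvd_iff dvdE)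
      have "g $ i $ j \<in> \<int>" "g' $ i $ j \<in> \<int>" using g SpZ_int[OF Gam2m2_SpZ] by (auto simp: intmat_def)
      then have "g $ i $ j - g' $ i $ j = of_int (\<lfloor>g $ i $ j\<rfloor> - \<lfloor>g' $ i $ j\<rfloor>)" by simp
      then show "\<exists>k. g $ i $ j - g' $ i $ j = of_int (4*m*k)" unfolding k by blast
    qed
    then have "g ** matrix_inv g' \<in> Gam (4*m)" using g Gam_quotI Gam2m2_SpZ by blast
    moreover have "g = (g ** matrix_inv g') ** g' ** mat 1"
      using g by (simp add: Sp_inv_left Gam2m2_Sp flip: matrix_mul_assoc)
    moreover have "(mat 1 :: 'n smat) \<in> Gaml 2" by (simp add: Gaml_iff_Gam)
    ultimately have "g \<in> dcoset (Gam (4*m)) g' (Gaml 2)" unfolding dcoset_def by blast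
    then show ?thesis by (rule dcoset_eq)
  qed
  have "(\<lambda>g. dcoset (Gam (4*m)) g (Gaml 2)) ` Gam2m2 m
     \<subseteq> (\<lambda>x. dcoset (Gam (4*m)) (inv_into (Gam2m2 m) r x) (Gaml 2)) ` r ` Gam2m2 m"
  proof (rule image_subsetI)
    fix g :: "'n smat" assume g: "g \<in> Gam2m2 m"
    have "dcoset (Gam (4*m)) g (Gaml 2) = dcoset (Gam (4*m)) (inv_into (Gam2m2 m) r (r g)) (Gaml 2)"
      using g by (intro eq) (auto intro: inv_into_into simp: f_inv_into_f)
    then show "dcoset (Gam (4*m)) g (Gaml 2)
      \<in> (\<lambda>x. dcoset (Gam (4*m)) (inv_into (Gam2m2 m) r x) (Gaml 2)) ` r ` Gam2m2 m" using g by blast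
  qed
  then show ?thesis using fin finite_subset by blast
qed

theorem theorem4p4:
  fixes m :: int
  assumes "m \<ge> 1"
  defines "G \<equiv> (Gam (4*m) :: 'n::finite smat set)"
  shows
    \<comment> \<open>tau preserves h_n and descends to X = G\h_n\<close>
    "(\<forall>Z::complex^'n^'n \<in> siegel. tauZ Z \<in> siegel)
     \<and> (\<forall>Z \<in> siegel. \<forall>W \<in> siegel. orb G Z = orb G W \<longrightarrow> orb G (tauZ Z) = orb G (tauZ W))
     \<comment> \<open>(i)\<close>
     \<and> XR G = orb G ` (\<Union>\<gamma> \<in> G. fixset \<gamma>)
     \<comment> \<open>(ii)\<close>
     \<and> (\<forall>g \<in> Gam2m2 m.
          (\<forall>h \<in> conjgrp g (Gaml (4*m)). act h ` (act g ` iCn) = act g ` iCn)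
        \<and> (\<forall>Z \<in> act g ` iCn. \<forall>W \<in> act g ` iCn.
              orb G Z = orb G W \<longleftrightarrow> (\<exists>h \<in> conjgrp g (Gaml (4*m)). W = act h Z))
        \<and> orb G ` (act g ` iCn) \<subseteq> XR G)
     \<and> (\<forall>g \<in> Gam2m2 m. \<forall>g' \<in> Gam2m2 m. g' \<in> dcoset G g (Gaml 2) \<longrightarrow>
          orb G ` (act g' ` iCn) = orb G ` (act g ` iCn))
     \<and> (\<forall>g \<in> Gam2m2 m. \<forall>g' \<in> Gam2m2 m. g' \<notin> dcoset G g (Gaml 2) \<longrightarrow>
          orb G ` (act g' ` iCn) \<inter> orb G ` (act g ` iCn) = {})
     \<and> finite ((\<lambda>g. dcoset G g (Gaml 2)) ` Gam2m2 m)
     \<and> XR G = (\<Union>g \<in> Gam2m2 m. orb G ` (act g ` iCn))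
     \<comment> \<open>(iii)\<close>
     \<and> (\<forall>g \<in> Gam2m2 m. tauM g ** matrix_inv g \<in> cocycles G)
     \<and> (\<forall>g \<in> Gam2m2 m. \<forall>g' \<in> Gam2m2 m. dcoset G g (Gaml 2) = dcoset G g' (Gaml 2) \<longrightarrow>
          cohclass G (tauM g ** matrix_inv g) = cohclass G (tauM g' ** matrix_inv g'))
     \<and> bij_betw
         (\<lambda>D. let g = (SOME g. g \<in> Gam2m2 m \<and> dcoset G g (Gaml 2) = D)
               in cohclass G (tauM g ** matrix_inv g))
         ((\<lambda>g. dcoset G g (Gaml 2)) ` Gam2m2 m) (H1 G)"
proof (intro conjI ballI impI)
  have act_g_siegel: "act g X \<in> siegel" if "g \<in> Gam2m2 m" "X \<in> iCn" for g X
    using that by (simp add: act_siegel Gam2m2_Sp iCn_siegel)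
  have GamlG: "h \<in> G" if "h \<in> Gaml (4*m)" for h
    using that by (simp add: G_def Gaml_iff_Gam)
  have conj_act: "act (g ** h ** matrix_inv g) (act g X) = act g (act h X)"
    if "g \<in> Gam2m2 m" "h \<in> Sp" "X \<in> iCn" for g h X
    using that by (simp add: act_mult act_siegel Sp_mult Sp_matrix_inv Gam2m2_Sp iCn_siegel act_inv_act)
  have coset_sub: "orb G ` (act g ` iCn) \<subseteq> XR G" if g: "g \<in> Gam2m2 m" for g
    using fixset_eq[OF Gam2m2_Sp[OF g]] Gam2m2_quot_Gam(1)[OF g] unfolding G_def XR_eq by blast
  show "tauZ Z \<in> siegel" if "Z \<in> siegel" for Z :: "complex^'n^'n" using that by (rule tauZ_siegel)
  show "orb G (tauZ Z) = orb G (tauZ W)" if Z: "Z \<in> siegel" "W \<in> siegel" "orb G Z = orb G W" for Z W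
  proof -
    obtain \<gamma> where \<gamma>: "\<gamma> \<in> G" "W = act \<gamma> Z" using Z unfolding G_def by (auto simp: orb_eq_iff)
    then have "tauZ W = act (tauM \<gamma>) (tauZ Z)" using Z by (simp add: tauZ_act G_def Gam_Sp)
    moreover have "tauM \<gamma> \<in> G" using \<gamma> by (simp add: G_def Gam_tauM)
    ultimately show ?thesis
      using orb_eq_iff[OF tauZ_siegel[OF Z(1)] tauZ_siegel[OF Z(2)]] unfolding G_def by blast
  qed
  show "XR G = orb G ` (\<Union>\<gamma> \<in> G. fixset \<gamma>)" unfolding G_def by (rule XR_eq)
  show "act h ` act g ` iCn = act g ` iCn" if g: "g \<in> Gam2m2 m" and h: "h \<in> conjgrp g (Gaml (4*m))" for g h
  proof -
    obtain k where k: "k \<in> Gaml (4*m)" "h = g ** k ** matrix_inv g" using h by (auto simp: conjgrp_def)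
    have "act h ` act g ` iCn = act g ` act k ` iCn"
      unfolding k(2) image_image using conj_act[OF g Gaml_Sp[OF k(1)]] by (intro image_cong) auto
    then show ?thesis using act_tauM_fixed_iCn[OF Gaml_Sp[OF k(1)] Gaml_tauM[OF k(1)]] by simp
  qed
  show "orb G Z = orb G W \<longleftrightarrow> (\<exists>h \<in> conjgrp g (Gaml (4*m)). W = act h Z)"
    if g: "g \<in> Gam2m2 m" and ZW: "Z \<in> act g ` iCn" "W \<in> act g ` iCn" for g Z W
  proof
    obtain X X' where X: "X \<in> iCn" "Z = act g X" and X': "X' \<in> iCn" "W = act g X'" using ZW by blast
    assume "orb G Z = orb G W"
    then obtain \<gamma> where \<gamma>: "\<gamma> \<in> Gam (4*m)" "W = act \<gamma> Z"
      using orb_eq_iff[OF act_g_siegel[OF g X(1)] act_g_siegel[OF g X'(1)]] X(2) X'(2) unfolding G_def by blast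
    \<comment> \<open>This element maps X to X', so it is \<tau>-fixed; conjugation by the integral
      \<open>g\<close> keeps it in \<open>Gam (4*m)\<close>.\<close>
    let ?h = "matrix_inv g ** \<gamma> ** g"
    have "tauM ?h = ?h" using orb_iCn_eq_D(1)[OF g g X(1) X'(1) \<gamma>(1)] \<gamma>(2) X X' by simp
    then have "?h \<in> Gaml (4*m)" using Gam_conj'[OF \<gamma>(1) Gam2m2_SpZ[OF g]] by (simp add: Gaml_iff_Gam)
    moreover have "\<gamma> = g ** ?h ** matrix_inv g"
    proof -
      have "g ** ?h ** matrix_inv g = (g ** matrix_inv g) ** \<gamma> ** (g ** matrix_inv g)"
        by (simp only: matrix_mul_assoc)
      then show ?thesis using g by (simp add: Sp_inv_right Gam2m2_Sp)
    qed
    ultimately show "\<exists>h \<in> conjgrp g (Gaml (4*m)). W = act h Z" using \<gamma>(2) unfolding conjgrp_def by blast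
  next
    have s: "Z \<in> siegel" "W \<in> siegel" using ZW act_g_siegel[OF g] by auto
    assume "\<exists>h \<in> conjgrp g (Gaml (4*m)). W = act h Z"
    then obtain k where k: "k \<in> Gaml (4*m)" "W = act (g ** k ** matrix_inv g) Z" by (auto simp: conjgrp_def)
    have "g ** k ** matrix_inv g \<in> G" using GamlG[OF k(1)] g unfolding G_def by (intro Gam_conj Gam2m2_SpZ)
    then show "orb G Z = orb G W" using k(2) s unfolding G_def by (subst orb_eq_iff) auto
  qed
  show "orb G ` act g ` iCn \<subseteq> XR G" if "g \<in> Gam2m2 m" for g using that by (rule coset_sub)
  show "orb G ` act g' ` iCn = orb G ` act g ` iCn"
    if g: "g \<in> Gam2m2 m" "g' \<in> Gam2m2 m" and d: "g' \<in> dcoset G g (Gaml 2)" for g g'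
  proof -
    obtain a b where ab: "g' = a ** g ** b" "a \<in> Gam (4*m)" "b \<in> Gaml 2" using d by (auto simp: dcoset_def G_def)
    have b: "act b ` iCn = iCn" using ab(3) by (intro act_tauM_fixed_iCn Gaml_Sp Gaml_tauM)
    \<comment> \<open>The left factor \<open>a\<close> moves points within their orbits, and
      \<open>b\<close> permutes \<open>iCn\<close>.\<close>
    have "orb G (act g' X) = orb G (act g (act b X))" if X: "X \<in> iCn" for X
    proof -
      have bX: "act b X \<in> iCn" using b X by blast
      have "act g' X = act a (act g (act b X))"
        using g ab X bX by (simp add: act_mult act_siegel Sp_mult Gam2m2_Sp Gam_Sp Gaml_Sp iCn_siegel)
      moreover have "act g' X \<in> siegel" "act g (act b X) \<in> siegel" using act_g_siegel g X bX by auto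
      ultimately show ?thesis using ab(2) orb_eq_iff unfolding G_def by metis
    qed
    then have "orb G ` act g' ` iCn = orb G ` act g ` act b ` iCn"
      unfolding image_image by (intro image_cong) auto
    then show ?thesis by (simp add: b)
  qed
  show "orb G ` act g' ` iCn \<inter> orb G ` act g ` iCn = {}"
    if g: "g \<in> Gam2m2 m" "g' \<in> Gam2m2 m" and d: "g' \<notin> dcoset G g (Gaml 2)" for g g'
  proof (rule ccontr)
    assume "orb G ` act g' ` iCn \<inter> orb G ` act g ` iCn \<noteq> {}"
    then obtain X X' where X: "X \<in> iCn" "X' \<in> iCn" "orb G (act g X) = orb G (act g' X')" by blast
    then obtain \<gamma> where \<gamma>: "\<gamma> \<in> Gam (4*m)" "act g' X' = act \<gamma> (act g X)"
      using orb_eq_iff[OF act_g_siegel[OF g(1) X(1)] act_g_siegel[OF g(2) X(2)]] unfolding G_def by blast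
    have "g' \<in> dcoset G g (Gaml 2)"
      unfolding G_def using dcosetI_tauM[OF g \<gamma>(1) orb_iCn_eq_D(1)[OF g X(1,2) \<gamma>]] .
    then show False using d by simp
  qed
  show "finite ((\<lambda>g. dcoset G g (Gaml 2)) ` Gam2m2 m)" unfolding G_def using assms(1) by (rule finite_dcosets)
  show "XR G = (\<Union>g \<in> Gam2m2 m. orb G ` act g ` iCn)"
  proof
    show "(\<Union>g \<in> Gam2m2 m. orb G ` act g ` iCn) \<subseteq> XR G" using coset_sub by blast
    show "XR G \<subseteq> (\<Union>g \<in> Gam2m2 m. orb G ` act g ` iCn)"
    proof
      fix x assume "x \<in> XR G"
      then obtain \<gamma> Z where Z: "\<gamma> \<in> Gam (4*m)" "Z \<in> fixset \<gamma>" "x = orb G Z" unfolding G_def XR_eq by blast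
      \<comment> \<open>Having a fixed point forces \<gamma> to be a cocycle, so it is a coboundary
        over \<open>Gam2m2 m\<close> and its fixed set is a translate of \<open>iCn\<close>.\<close>
      obtain g where g: "g \<in> Gam2m2 m" "\<gamma> = tauM g ** matrix_inv g"
        using cocycle_trivial[OF Z(1) fixset_Gam_cocycle[OF Z(1,2)]] .
      have "Z \<in> act g ` iCn" using Z(2) unfolding g(2) fixset_eq[OF Gam2m2_Sp[OF g(1)]] .
      then show "x \<in> (\<Union>g \<in> Gam2m2 m. orb G ` act g ` iCn)" using g(1) Z(3) by blast
    qed
  qed
  show "tauM g ** matrix_inv g \<in> cocycles G" if "g \<in> Gam2m2 m" for g
    unfolding G_def using that by (rule cocycle_of_Gam2m2)
  show "cohclass G (tauM g ** matrix_inv g) = cohclass G (tauM g' ** matrix_inv g')"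
    if "g \<in> Gam2m2 m" "g' \<in> Gam2m2 m" "dcoset G g (Gaml 2) = dcoset G g' (Gaml 2)" for g g'
    using that unfolding G_def by (simp add: cohclass_eq_iff_dcoset_eq)
  let ?d = "\<lambda>g. dcoset G g (Gaml 2)"
  let ?c = "\<lambda>g. cohclass G (tauM g ** matrix_inv g)"
  let ?F = "\<lambda>D. let g = (SOME g. g \<in> Gam2m2 m \<and> ?d g = D) in ?c g"
  \<comment> \<open>The class is the same for every representative of the double coset, so the one
    picked by \<open>SOME\<close> may be replaced by \<open>g\<close>.\<close>
  have F: "?F (?d g) = ?c g" if g: "g \<in> Gam2m2 m" for g
  proof -
    define s where "s = (SOME s. s \<in> Gam2m2 m \<and> ?d s = ?d g)"
    have "s \<in> Gam2m2 m \<and> ?d s = ?d g" unfolding s_def by (rule someI[of _ g]) (simp add: g)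
    then have "?c s = ?c g" using g unfolding G_def by (simp add: cohclass_eq_iff_dcoset_eq)
    then show ?thesis by (simp add: s_def)
  qed
  show "bij_betw ?F (?d ` Gam2m2 m) (H1 G)"
  proof (rule bij_betw_imageI)
    show "inj_on ?F (?d ` Gam2m2 m)"
    proof (rule inj_onI)
      fix x y assume "x \<in> ?d ` Gam2m2 m" "y \<in> ?d ` Gam2m2 m" and eq: "?F x = ?F y"
      then obtain g g' where g: "g \<in> Gam2m2 m" "x = ?d g" "g' \<in> Gam2m2 m" "y = ?d g'" by blast
      have "?c g = ?c g'" using eq unfolding g(2,4) F[OF g(1)] F[OF g(3)] .
      then show "x = y" using g unfolding G_def by (simp add: cohclass_eq_iff_dcoset_eq)
    qed
    have "?F ` ?d ` Gam2m2 m = ?c ` Gam2m2 m" unfolding image_image using F by (rule image_cong[OF refl])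
    also have "\<dots> = H1 G"
    proof
      show "?c ` Gam2m2 m \<subseteq> H1 G" using cocycle_of_Gam2m2 by (auto simp: H1_def G_def)
      show "H1 G \<subseteq> ?c ` Gam2m2 m"
      proof
        fix x assume "x \<in> H1 G"
        then obtain \<gamma> where \<gamma>: "\<gamma> \<in> Gam (4*m)" "\<gamma> ** tauM \<gamma> = mat 1" "x = cohclass G \<gamma>"
          by (auto simp: H1_def G_def cocycles_def)
        then show "x \<in> ?c ` Gam2m2 m" using cocycle_trivial[OF \<gamma>(1,2)] by blast
      qed
    qed
    finally show "?F ` ?d ` Gam2m2 m = H1 G" .
  qed
qed

end
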